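(* If $\mathcal{G}$ is a model of $\phi_{\mathcal{F}}$, then $(V(\mathcal{G}),\triangleleft)$ is a linear order with character $\chi(V(\mathcal{G}),\triangleleft)=cf(M(\mathcal{G}),<)$.
   Context: Fix a countable structure $\mathcal{M}$ in a countable language $\mathcal{L}_0$ containing a binary relation symbol $<$ interpreted as a linear order on $\mathcal{M}$, whose Scott sentence $\phi$ has a model of cardinality $\aleph_1$ but none of cardinality $\aleph_2$. Let $\mathcal{L}$ extend $\mathcal{L}_0$ by unary predicates $V,M,N$, a binary relation $\triangleleft$ and a binary function symbol $f$. $K(\mathcal{M})$ is the class of countable $\mathcal{L}$-structures $\mathcal{A}$ such that: (1) $V(\mathcal{A}),M(\mathcal{A})$ partition the universe, $V(\mathcal{A})$ is finite and $M(\mathcal{A})$ (with its $\mathcal{L}_0$-structure) is $\mathcal{M}$; (2) $\triangleleft$ is a linear order on $V(\mathcal{A})$; (3) for $x\ne y$ in $V(\mathcal{A})$, $f(x,y)=f(y,x)\in M(\mathcal{A})$; (4) if $x\triangleleft y\triangleleft z$ are distinct elements of $V(\mathcal{A})$, then either $f(x,y)=f(x,z)=f(y,z)$, or $f(x,y)=f(x,z)<f(y,z)$, or $f(x,z)=f(y,z)<f(x,y)$; (5) $N(x)$ implies $x\in V(\mathcal{A})$. A finitely generated$/\mathcal{M}$ substructure of a structure containing $\mathcal{M}$ is one of the form $\langle A_0\rangle\cup\mathcal{M}$, $A_0$ finite. $\mathcal{F}$ is the Fraïssé limit of $K(\mathcal{M})$: the (unique up to isomorphism) countable $\mathcal{L}$-structure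 containing $\mathcal{M}$ whose finitely generated$/\mathcal{M}$ substructures are, up to isomorphism, exactly the members of $K(\mathcal{M})$ and in which every isomorphism between finitely generated$/\mathcal{M}$ substructures extends to an automorphism; $\phi_{\mathcal{F}}$ is its Scott sentence. For a linear order $(L,<)$ and $m\in L$, the left character of $m$ is the least cardinal $\kappa$ admitting a cofinal map from $\kappa$ into $\{n:n<m\}$, the right character the least $\kappa$ admitting a coinitial map from $\kappa$ into $\{n:n>m\}$; $\chi(m)$ is the smaller of the two, and $\chi(L,<)=\min\{\chi(m):m\in L\}$.
   Formalization: Adds that (M,<) has no greatest element (otherwise cf(M,<)=1 while χ(V(F))=ω), and fixes f, ◁ and the L_0-symbols trivially outside their intended domains (relations false, functions return the first argument), as otherwise K(M) lacks joint embedding. *)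

theory Defs
  imports Main "HOL-Library.Countable_Set"
begin

unbundle cardinal_syntax

record ('f, 'r) lang =
  funs :: "'f set"
  rels :: "'r set"
  fun_ar :: "'f \<Rightarrow> nat"
  rel_ar :: "'r \<Rightarrow> nat"

text \<open>Only the values on tuples of the right length from the universe are meaningful.\<close>

record ('f, 'r, 'a) struct =
  univ :: "'a set"
  fint :: "'f \<Rightarrow> 'a list \<Rightarrow> 'a"
  rint :: "'r \<Rightarrow> 'a list \<Rightarrow> bool"

definition countable_lang :: "('f, 'r) lang \<Rightarrow> bool" where
  "countable_lang L \<longleftrightarrow> countable (funs L) \<and> countable (rels L)"

definition tuples :: "'a set \<Rightarrow> nat \<Rightarrow> 'a list set" where
  "tuples X n = {xs. set xs \<subseteq> X \<and> length xs = n}"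

definition closed_under :: "('f, 'r) lang \<Rightarrow> ('f, 'r, 'a) struct \<Rightarrow> 'a set \<Rightarrow> bool" where
  "closed_under L A X \<longleftrightarrow> (\<forall>s\<in>funs L. \<forall>xs\<in>tuples X (fun_ar L s). fint A s xs \<in> X)"

definition is_struct :: "('f, 'r) lang \<Rightarrow> ('f, 'r, 'a) struct \<Rightarrow> bool" where
  "is_struct L A \<longleftrightarrow> univ A \<noteq> {} \<and> closed_under L A (univ A)"

definition is_iso ::
  "('f, 'r) lang \<Rightarrow> ('f, 'r, 'a) struct \<Rightarrow> ('f, 'r, 'b) struct \<Rightarrow> ('a \<Rightarrow> 'b) \<Rightarrow> bool" where
  "is_iso L A B h \<longleftrightarrow>
     bij_betw h (univ A) (univ B) \<and>
     (\<forall>s\<in>funs L. \<forall>xs\<in>tuples (univ A) (fun_ar L s). h (fint A s xs) = fint B s (map h xs)) \<and>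
     (\<forall>R\<in>rels L. \<forall>xs\<in>tuples (univ A) (rel_ar L R). rint A R xs \<longleftrightarrow> rint B R (map h xs))"

definition isomorphic ::
  "('f, 'r) lang \<Rightarrow> ('f, 'r, 'a) struct \<Rightarrow> ('f, 'r, 'b) struct \<Rightarrow> bool" where
  "isomorphic L A B \<longleftrightarrow> (\<exists>h. is_iso L A B h)"

definition restr :: "('f, 'r, 'a) struct \<Rightarrow> 'a set \<Rightarrow> ('f, 'r, 'a) struct" where
  "restr A X = A\<lparr>univ := X\<rparr>"

definition generated :: "('f, 'r) lang \<Rightarrow> ('f, 'r, 'a) struct \<Rightarrow> 'a set \<Rightarrow> 'a set" where
  "generated L A A0 = \<Inter>{X. A0 \<subseteq> X \<and> X \<subseteq> univ A \<and> closed_under L A X}"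

definition rel_on :: "('f, 'r, 'a) struct \<Rightarrow> 'r \<Rightarrow> 'a set \<Rightarrow> 'a rel" where
  "rel_on A R X = {(x, y). x \<in> X \<and> y \<in> X \<and> rint A R [x, y]}"

text \<open>
  The logic $L_{\omega_1,\omega}$.  A subformula of a sentence automatically has only finitely many
  free variables, since only finitely many quantifiers stand above it.
\<close>

datatype 'f tm = Var nat | App 'f "'f tm list"

datatype ('f, 'r) fm =
    FEq "'f tm" "'f tm"
  | FRel 'r "'f tm list"
  | FNot "('f, 'r) fm"
  | FConj "nat \<Rightarrow> ('f, 'r) fm"
  | FEx nat "('f, 'r) fm"

primrec tm_vars :: "'f tm \<Rightarrow> nat set" where
  "tm_vars (Var i) = {i}"
| "tm_vars (App s ts) = \<Union>(set (map tm_vars ts))"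

primrec tm_wf :: "('f, 'r) lang \<Rightarrow> 'f tm \<Rightarrow> bool" where
  "tm_wf L (Var i) \<longleftrightarrow> True"
| "tm_wf L (App s ts) \<longleftrightarrow>
     s \<in> funs L \<and> length ts = fun_ar L s \<and> (\<forall>b\<in>set (map (tm_wf L) ts). b)"

primrec tm_val :: "('f, 'r, 'a) struct \<Rightarrow> (nat \<Rightarrow> 'a) \<Rightarrow> 'f tm \<Rightarrow> 'a" where
  "tm_val A e (Var i) = e i"
| "tm_val A e (App s ts) = fint A s (map (tm_val A e) ts)"

primrec free_vars :: "('f, 'r) fm \<Rightarrow> nat set" where
  "free_vars (FEq t u) = tm_vars t \<union> tm_vars u"
| "free_vars (FRel R ts) = (\<Union>t\<in>set ts. tm_vars t)"
| "free_vars (FNot p) = free_vars p"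
| "free_vars (FConj ps) = (\<Union>n. free_vars (ps n))"
| "free_vars (FEx i p) = free_vars p - {i}"

primrec fm_wf :: "('f, 'r) lang \<Rightarrow> ('f, 'r) fm \<Rightarrow> bool" where
  "fm_wf L (FEq t u) \<longleftrightarrow> tm_wf L t \<and> tm_wf L u"
| "fm_wf L (FRel R ts) \<longleftrightarrow> R \<in> rels L \<and> length ts = rel_ar L R \<and> (\<forall>t\<in>set ts. tm_wf L t)"
| "fm_wf L (FNot p) \<longleftrightarrow> fm_wf L p"
| "fm_wf L (FConj ps) \<longleftrightarrow> (\<forall>n. fm_wf L (ps n))"
| "fm_wf L (FEx i p) \<longleftrightarrow> fm_wf L p"

primrec sat :: "('f, 'r, 'a) struct \<Rightarrow> (nat \<Rightarrow> 'a) \<Rightarrow> ('f, 'r) fm \<Rightarrow> bool" where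
  "sat A e (FEq t u) \<longleftrightarrow> tm_val A e t = tm_val A e u"
| "sat A e (FRel R ts) \<longleftrightarrow> rint A R (map (tm_val A e) ts)"
| "sat A e (FNot p) \<longleftrightarrow> \<not> sat A e p"
| "sat A e (FConj ps) \<longleftrightarrow> (\<forall>n. sat A e (ps n))"
| "sat A e (FEx i p) \<longleftrightarrow> (\<exists>a\<in>univ A. sat A (e(i := a)) p)"

definition sentence :: "('f, 'r) lang \<Rightarrow> ('f, 'r) fm \<Rightarrow> bool" where
  "sentence L p \<longleftrightarrow> fm_wf L p \<and> free_vars p = {}"

definition model_of :: "('f, 'r) lang \<Rightarrow> ('f, 'r) fm \<Rightarrow> ('f, 'r, 'a) struct \<Rightarrow> bool" where
  "model_of L p A \<longleftrightarrow> is_struct L A \<and> (\<forall>e. range e \<subseteq> univ A \<longrightarrow> sat A e p)"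

text \<open>
  A Scott sentence of \<open>A\<close> is true in \<open>A\<close> and has no other countable models up to isomorphism.
  Every countable structure has an isomorphic copy whose universe is a set of natural numbers.
\<close>

definition scott_sentence :: "('f, 'r) lang \<Rightarrow> ('f, 'r, 'a) struct \<Rightarrow> ('f, 'r) fm \<Rightarrow> bool" where
  "scott_sentence L A p \<longleftrightarrow>
     sentence L p \<and> model_of L p A \<and>
     (\<forall>B :: ('f, 'r, nat) struct. model_of L p B \<longrightarrow> isomorphic L A B)"

abbreviation aleph1 :: "nat set rel" where
  "aleph1 \<equiv> cardSuc natLeq"

abbreviation aleph2 :: "nat set set rel" where
  "aleph2 \<equiv> cardSuc aleph1"

text \<open>
  The type of sets of sets of naturals has at least \<open>aleph2\<close> elements, so every structure of
  cardinality at most \<open>aleph2\<close> has an isomorphic copy with universe in this type.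
\<close>

definition has_model_of_card :: "('f, 'r) lang \<Rightarrow> ('f, 'r) fm \<Rightarrow> 'c rel \<Rightarrow> bool" where
  "has_model_of_card L p \<kappa> \<longleftrightarrow>
     (\<exists>A :: ('f, 'r, nat set set) struct. model_of L p A \<and> card_of (univ A) =o \<kappa>)"

datatype 'f xfun = OldF 'f | F_sym

datatype 'r xrel = OldR 'r | V_sym | M_sym | N_sym | Tri_sym

definition xlang :: "('f, 'r) lang \<Rightarrow> ('f xfun, 'r xrel) lang" where
  "xlang L0 = \<lparr>
     funs = OldF ` funs L0 \<union> {F_sym},
     rels = OldR ` rels L0 \<union> {V_sym, M_sym, N_sym, Tri_sym},
     fun_ar = case_xfun (fun_ar L0) 2,
     rel_ar = case_xrel (rel_ar L0) 1 1 1 2\<rparr>"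

type_synonym ('f, 'r, 'a) xstruct = "('f xfun, 'r xrel, 'a) struct"

definition Vpart :: "('f, 'r, 'a) xstruct \<Rightarrow> 'a set" where
  "Vpart A = {x \<in> univ A. rint A V_sym [x]}"

definition Mpart :: "('f, 'r, 'a) xstruct \<Rightarrow> 'a set" where
  "Mpart A = {x \<in> univ A. rint A M_sym [x]}"

definition Npart :: "('f, 'r, 'a) xstruct \<Rightarrow> 'a set" where
  "Npart A = {x \<in> univ A. rint A N_sym [x]}"

definition Mstruct :: "('f, 'r, 'a) xstruct \<Rightarrow> ('f, 'r, 'a) struct" where
  "Mstruct A = \<lparr>univ = Mpart A, fint = \<lambda>s. fint A (OldF s), rint = \<lambda>R. rint A (OldR R)\<rparr>"

abbreviation ff :: "('f, 'r, 'a) xstruct \<Rightarrow> 'a \<Rightarrow> 'a \<Rightarrow> 'a" where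
  "ff A x y \<equiv> fint A F_sym [x, y]"

abbreviation tri :: "('f, 'r, 'a) xstruct \<Rightarrow> 'a rel" where
  "tri A \<equiv> rel_on A Tri_sym (Vpart A)"

abbreviation less_M :: "'r \<Rightarrow> ('f, 'r, 'a) xstruct \<Rightarrow> 'a rel" where
  "less_M lt A \<equiv> rel_on A (OldR lt) (Mpart A)"

text \<open>
  Symbols are interpreted trivially outside their intended domain: the old symbols live on the
  \<open>M\<close>-part, the binary relation on the \<open>V\<close>-part, the binary function on pairs of distinct elements of
  the \<open>V\<close>-part.  Relations are false and functions return their first argument elsewhere.  Without
  such a convention the class below would not have the joint embedding property.
\<close>

definition trivial_off_domain :: "('f, 'r) lang \<Rightarrow> ('f, 'r, 'a) xstruct \<Rightarrow> bool" where
  "trivial_off_domain L0 A \<longleftrightarrow>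
     (\<forall>R\<in>rels L0. \<forall>xs\<in>tuples (univ A) (rel_ar L0 R).
        rint A (OldR R) xs \<longrightarrow> set xs \<subseteq> Mpart A) \<and>
     (\<forall>s\<in>funs L0. \<forall>xs\<in>tuples (univ A) (fun_ar L0 s).
        \<not> set xs \<subseteq> Mpart A \<longrightarrow> fint A (OldF s) xs = hd xs) \<and>
     (\<forall>x\<in>univ A. \<forall>y\<in>univ A. rint A Tri_sym [x, y] \<longrightarrow> x \<in> Vpart A \<and> y \<in> Vpart A) \<and>
     (\<forall>x\<in>univ A. \<forall>y\<in>univ A. \<not> (x \<in> Vpart A \<and> y \<in> Vpart A \<and> x \<noteq> y) \<longrightarrow> ff A x y = x)"

definition in_K ::
  "('f, 'r) lang \<Rightarrow> 'r \<Rightarrow> ('f, 'r, 'm) struct \<Rightarrow> ('f, 'r, 'a) xstruct \<Rightarrow> bool" where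
  "in_K L0 lt M A \<longleftrightarrow>
     is_struct (xlang L0) A \<and> countable (univ A) \<and> trivial_off_domain L0 A \<and>
     Vpart A \<union> Mpart A = univ A \<and> Vpart A \<inter> Mpart A = {} \<and> finite (Vpart A) \<and>
     is_struct L0 (Mstruct A) \<and> isomorphic L0 (Mstruct A) M \<and>
     strict_linear_order_on (Vpart A) (tri A) \<and>
     (\<forall>x\<in>Vpart A. \<forall>y\<in>Vpart A. x \<noteq> y \<longrightarrow> ff A x y = ff A y x \<and> ff A x y \<in> Mpart A) \<and>
     (\<forall>x y z. (x, y) \<in> tri A \<and> (y, z) \<in> tri A \<longrightarrow>
        (ff A x y = ff A x z \<and> ff A x z = ff A y z) \<or>
        (ff A x y = ff A x z \<and> (ff A x z, ff A y z) \<in> less_M lt A) \<or>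
        (ff A x z = ff A y z \<and> (ff A y z, ff A x y) \<in> less_M lt A)) \<and>
     Npart A \<subseteq> Vpart A"

definition fin_gen_over ::
  "('f, 'r) lang \<Rightarrow> ('f, 'r, 'a) struct \<Rightarrow> 'a set \<Rightarrow> 'a set \<Rightarrow> bool" where
  "fin_gen_over L A M0 X \<longleftrightarrow>
     (\<exists>A0. finite A0 \<and> A0 \<subseteq> univ A \<and> X = generated L A A0 \<union> M0)"

text \<open>
  The copy of \<open>M\<close> contained in \<open>F\<close> is its \<open>M\<close>-part.  Members of the class are countable, so up to
  isomorphism all of them occur with a universe consisting of natural numbers.
\<close>

definition fraisse_limit ::
  "('f, 'r) lang \<Rightarrow> 'r \<Rightarrow> ('f, 'r, 'm) struct \<Rightarrow> ('f, 'r, 'a) xstruct \<Rightarrow> bool" where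
  "fraisse_limit L0 lt M F \<longleftrightarrow>
     is_struct (xlang L0) F \<and> countable (univ F) \<and>
     is_struct L0 (Mstruct F) \<and> isomorphic L0 (Mstruct F) M \<and>
     (\<forall>X. fin_gen_over (xlang L0) F (Mpart F) X \<longrightarrow> in_K L0 lt M (restr F X)) \<and>
     (\<forall>B :: ('f, 'r, nat) xstruct. in_K L0 lt M B \<longrightarrow>
        (\<exists>X. fin_gen_over (xlang L0) F (Mpart F) X \<and> isomorphic (xlang L0) (restr F X) B)) \<and>
     (\<forall>X Y h. fin_gen_over (xlang L0) F (Mpart F) X \<and> fin_gen_over (xlang L0) F (Mpart F) Y \<and>
        is_iso (xlang L0) (restr F X) (restr F Y) h \<longrightarrow>
        (\<exists>g. is_iso (xlang L0) F F g \<and> (\<forall>x\<in>X. g x = h x)))"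

text \<open>
  Cofinality and characters of a strict linear order \<open>r\<close>.  Cardinals are cardinal orders on the
  underlying type, determined up to \<open>=o\<close>; that type suffices because the cardinality of the
  order itself already admits a cofinal map.
\<close>

definition cofinal_map :: "'a rel \<Rightarrow> 'a set \<Rightarrow> 'b rel \<Rightarrow> ('b \<Rightarrow> 'a) \<Rightarrow> bool" where
  "cofinal_map r X \<kappa> g \<longleftrightarrow>
     g ` Field \<kappa> \<subseteq> X \<and> (\<forall>x\<in>X. \<exists>i\<in>Field \<kappa>. x = g i \<or> (x, g i) \<in> r)"

definition least_in :: "'a rel set \<Rightarrow> 'a rel" where
  "least_in C = (SOME \<kappa>. \<kappa> \<in> C \<and> (\<forall>\<kappa>'\<in>C. \<kappa> \<le>o \<kappa>'))"

definition cofinality :: "'a set \<Rightarrow> 'a rel \<Rightarrow> 'a rel" where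
  "cofinality X r = least_in {\<kappa>. Card_order \<kappa> \<and> (\<exists>g. cofinal_map r X \<kappa> g)}"

definition left_char :: "'a set \<Rightarrow> 'a rel \<Rightarrow> 'a \<Rightarrow> 'a rel" where
  "left_char X r m = cofinality {n \<in> X. (n, m) \<in> r} r"

definition right_char :: "'a set \<Rightarrow> 'a rel \<Rightarrow> 'a \<Rightarrow> 'a rel" where
  "right_char X r m = cofinality {n \<in> X. (m, n) \<in> r} (r\<inverse>)"

definition point_char :: "'a set \<Rightarrow> 'a rel \<Rightarrow> 'a \<Rightarrow> 'a rel" where
  "point_char X r m = least_in {left_char X r m, right_char X r m}"

definition order_char :: "'a set \<Rightarrow> 'a rel \<Rightarrow> 'a rel" where
  "order_char X r = least_in (point_char X r ` X)"

end

theory Submission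
  imports Defs
begin

text \<open>
  For a point $x$ of the \<open>V\<close>-part, condition (4) makes $y \mapsto f(y,x)$ monotone from the points below
  $x$ into the \<open>M\<close>-part, and antitone on the points above $x$.  In the limit both maps are onto the
  \<open>M\<close>-part: a member of the class with just two \<open>V\<close>-points embeds with any prescribed value, and
  homogeneity moves one of its points to $x$.  Since the \<open>M\<close>-part has no greatest element, a cofinal map
  on either side of $x$ yields one into the \<open>M\<close>-part and conversely, so both characters of every point
  equal the cofinality of the \<open>M\<close>-part.  These properties carry over to an uncountable model of the
  Scott sentence because, by downward Loewenheim-Skolem, any three of its elements lie in a countable
  model, which is a copy of the limit.
\<close>

section \<open>The downward Loewenheim-Skolem theorem\<close>

text \<open>The Scott sentence is never analysed syntactically; all that is used of it is which
  countable models it has. Hence everything needed about an arbitrary model must be visible on a few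
  elements at a time, and this decides the form of \<open>V_axioms\<close>. The maps into the M-part
  need not be injective, so orders are compared only up to cofinality. Large fibres do no harm: a
  point with a strictly larger value lies beyond the whole fibre. This is where
  \<open>no_greatest\<close> enters. If M had a greatest element, its cofinality would be 1, whereas
  homogeneity puts between any y below x and x itself a further point with the same value at x, so
  that the characters would be infinite. Over the M-part a single V-point is described completely by
  whether N holds of it. So two versions of the two-point structure, with N true or false on both
  points, are enough to match every point of the limit.\<close>

lemma univ_restr [simp]: "univ (restr A X) = X"
  and fint_restr [simp]: "fint (restr A X) = fint A"
  and rint_restr [simp]: "rint (restr A X) = rint A"
  by (simp_all add: restr_def)

lemma tm_val_restr [simp]: "tm_val (restr A X) e = tm_val A e"
proof
  show "tm_val (restr A X) e t = tm_val A e t" for t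
    by (induction t) (simp_all cong: map_cong)
qed

lemma tm_val_cong: "(\<And>i. i \<in> tm_vars t \<Longrightarrow> e i = e' i) \<Longrightarrow> tm_val A e t = tm_val A e' t"
proof (induction t)
  case (App s ts)
  then have "map (tm_val A e) ts = map (tm_val A e') ts" by auto
  then show ?case by (simp only: tm_val.simps)
qed simp

lemma sat_cong:
  "(\<And>i. i \<in> free_vars p \<Longrightarrow> e i = e' i) \<Longrightarrow> sat A e p \<longleftrightarrow> sat A e' p"
proof (induction p arbitrary: e e')
  case (FEq t u)
  then have "tm_val A e t = tm_val A e' t" "tm_val A e u = tm_val A e' u"
    by (auto intro: tm_val_cong)
  then show ?case by simp
next
  case (FRel R ts)
  then have "map (tm_val A e) ts = map (tm_val A e') ts" by (auto intro: tm_val_cong)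
  then show ?case by (simp only: sat.simps)
next
  case (FNot p)
  then have "sat A e p \<longleftrightarrow> sat A e' p" by (metis free_vars.simps(3))
  then show ?case by simp
next
  case (FConj ps)
  have "sat A e (ps n) \<longleftrightarrow> sat A e' (ps n)" for n
    using FConj.IH[of "ps n" e e'] FConj.prems by auto
  then show ?case by simp
next
  case (FEx i p)
  have "sat A (e(i := a)) p \<longleftrightarrow> sat A (e'(i := a)) p" for a
    using FEx.prems by (intro FEx.IH) auto
  then show ?case by simp
qed

text \<open>Operations on lists treat all arities alike. The stages increase and a list has finitely
  many entries, so it lies in a single stage, and the next stage contains every value on it.\<close>

lemma countable_closure_under_operations:
  fixes H :: "('a list \<Rightarrow> 'a) set"
  assumes "countable H" "countable S" "S \<subseteq> U" and H: "\<And>h xs. h \<in> H \<Longrightarrow> xs \<in> lists U \<Longrightarrow> h xs \<in> U"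
  obtains X where "countable X" "S \<subseteq> X" "X \<subseteq> U" "\<And>h xs. h \<in> H \<Longrightarrow> xs \<in> lists X \<Longrightarrow> h xs \<in> X"
proof -
  define T where "T Y = Y \<union> (\<Union>h\<in>H. h ` lists Y)" for Y
  define X where "X = (\<Union>n. (T ^^ n) S)"
  have mono: "(T ^^ m) S \<subseteq> (T ^^ n) S" if "m \<le> n" for m n
    using that by (rule lift_Suc_mono_le[rotated]) (auto simp: T_def)
  have "countable ((T ^^ n) S)" for n
    by (induction n) (use assms(1,2) in \<open>auto simp: T_def\<close>)
  then have "countable X" by (simp add: X_def)
  moreover have "S \<subseteq> X" unfolding X_def by (rule subset_trans[OF _ UN_upper[of 0]]) auto
  moreover have "(T ^^ n) S \<subseteq> U" for n
  proof (induction n)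
    case (Suc n)
    from lists_mono[OF this] Suc have "T ((T ^^ n) S) \<subseteq> U" using H unfolding T_def by blast
    then show ?case by simp
  qed (use assms(3) in simp)
  then have "X \<subseteq> U" by (auto simp: X_def)
  moreover have "h xs \<in> X" if "h \<in> H" "xs \<in> lists X" for h xs
  proof -
    have "\<exists>n. xs \<in> lists ((T ^^ n) S)"
      using that(2)
    proof (induction xs)
      case (Cons x xs)
      then obtain m n where "x \<in> (T ^^ m) S" "xs \<in> lists ((T ^^ n) S)" by (auto simp: X_def)
      then have "x # xs \<in> lists ((T ^^ max m n) S)"
        using mono[of m "max m n"] mono[of n "max m n"] by auto
      then show ?case by blast
    qed simp
    then obtain n where "xs \<in> lists ((T ^^ n) S)" by blast
    then have "h xs \<in> (T ^^ Suc n) S" using that(1) by (auto simp: T_def)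
    then show ?thesis unfolding X_def by blast
  qed
  ultimately show ?thesis using that by blast
qed

text \<open>An infinite conjunction costs only a countable union, since the conclusion for
  \<open>H\<close> persists for every larger set of operations. Finiteness of the free variables
  matters at the quantifier: a witness then depends on finitely many values of the assignment, which
  can be passed as a list.\<close>

lemma skolem_functions:
  fixes A :: "('f, 'r, 'a) struct"
  assumes "univ A \<noteq> {}" "finite (free_vars p)"
  shows "\<exists>H. countable H \<and> (\<forall>h\<in>H. \<forall>xs\<in>lists (univ A). h xs \<in> univ A) \<and>
    (\<forall>X e. X \<subseteq> univ A \<and> (\<forall>h\<in>H. \<forall>xs\<in>lists X. h xs \<in> X) \<and> range e \<subseteq> X \<longrightarrow>
      (sat (restr A X) e p \<longleftrightarrow> sat A e p))"
    (is "\<exists>H. countable H \<and> ?into H \<and> ?elem H p")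
  using assms(2)
proof (induction p)
  case (FEq t u)
  show ?case by (rule exI[of _ "{}"]) simp
next
  case (FRel R ts)
  show ?case by (rule exI[of _ "{}"]) simp
next
  case (FNot p)
  then show ?case by simp
next
  case (FConj ps)
  have "\<exists>H. countable H \<and> ?into H \<and> ?elem H (ps n)" for n
  proof (rule FConj.IH)
    show "finite (free_vars (ps n))" by (rule finite_subset[OF _ FConj.prems]) auto
  qed auto
  then obtain H where H: "\<And>n. countable (H n)" "\<And>n. ?into (H n)" "\<And>n. ?elem (H n) (ps n)"
    by metis
  have "?elem (\<Union>n. H n) (FConj ps)"
  proof (intro allI impI)
    fix X and e :: "nat \<Rightarrow> 'a" assume X: "X \<subseteq> univ A \<and> (\<forall>h\<in>\<Union>n. H n. \<forall>xs\<in>lists X. h xs \<in> X) \<and> range e \<subseteq> X"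
    have "sat (restr A X) e (ps n) \<longleftrightarrow> sat A e (ps n)" for n
      by (rule H(3)[rule_format]) (use X in blast)
    then show "sat (restr A X) e (FConj ps) \<longleftrightarrow> sat A e (FConj ps)" by simp
  qed
  moreover have "countable (\<Union>n. H n)" using H(1) by simp
  moreover have "?into (\<Union>n. H n)" using H(2) by blast
  ultimately show ?case by blast
next
  case (FEx i p)
  from assms(1) obtain u where u: "u \<in> univ A" by blast
  have "finite (free_vars p)" using FEx.prems by simp
  from FEx.IH[OF this] obtain H where H: "countable H" "?into H" "?elem H p" by blast
  from \<open>finite (free_vars p)\<close> obtain n where n: "free_vars p \<subseteq> {..<n}"
    using finite_nat_iff_bounded by blast
  \<comment> \<open>The list holds the values of the first variables; past its end the default
    \<open>u\<close> is used.\<close>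
  define env where "env xs j = (if j < length xs then xs ! j else u)" for xs :: "'a list" and j
  \<comment> \<open>A choice of witness. The default \<open>u\<close> keeps \<open>w\<close> inside
    the universe when there is none.\<close>
  define w where "w xs = (if \<exists>a\<in>univ A. sat A ((env xs)(i := a)) p
    then SOME a. a \<in> univ A \<and> sat A ((env xs)(i := a)) p else u)" for xs
  have w: "w xs \<in> univ A \<and> sat A ((env xs)(i := w xs)) p"
    if "\<exists>a\<in>univ A. sat A ((env xs)(i := a)) p" for xs
    using someI_ex[of "\<lambda>a. a \<in> univ A \<and> sat A ((env xs)(i := a)) p"] that by (auto simp: w_def)
  have into: "w xs \<in> univ A" for xs
    using w[of xs] u by (cases "\<exists>a\<in>univ A. sat A ((env xs)(i := a)) p") (auto simp: w_def)
  have "?elem (insert w H) (FEx i p)"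
  proof (intro allI impI)
    fix X and e :: "nat \<Rightarrow> 'a"
    assume X: "X \<subseteq> univ A \<and> (\<forall>h\<in>insert w H. \<forall>xs\<in>lists X. h xs \<in> X) \<and> range e \<subseteq> X"
    have elem: "sat (restr A X) (e(i := a)) p \<longleftrightarrow> sat A (e(i := a)) p" if "a \<in> X" for a
      by (rule H(3)[rule_format]) (use X that in auto)
    \<comment> \<open>The first \<open>n\<close> values of \<open>e\<close> cover all free variables
      of \<open>p\<close>, so the default in \<open>env\<close> is never consulted.\<close>
    have env: "sat A ((env (map e [0..<n]))(i := a)) p \<longleftrightarrow> sat A (e(i := a)) p" for a
      by (rule sat_cong) (use n in \<open>auto simp: env_def\<close>)
    have "map e [0..<n] \<in> lists X" using X by (auto simp: image_subset_iff)
    then have "w (map e [0..<n]) \<in> X" using X by blast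
    then have "\<exists>a\<in>X. sat A (e(i := a)) p" if "\<exists>a\<in>univ A. sat A (e(i := a)) p"
      using w[of "map e [0..<n]"] that unfolding env by blast
    then show "sat (restr A X) e (FEx i p) \<longleftrightarrow> sat A e (FEx i p)"
      using X elem by auto
  qed
  moreover have "?into (insert w H)" using H(2) into by blast
  ultimately show ?case using H(1) by blast
qed

text \<open>The set is closed under two kinds of operations at once: the function symbols make it a
  structure, the Skolem functions preserve the truth of \<open>p\<close>.\<close>

theorem downward_Loewenheim_Skolem:
  assumes "countable (funs L)" "sentence L p" "model_of L p A" "countable S" "S \<subseteq> univ A"
  obtains X where "countable X" "S \<subseteq> X" "X \<subseteq> univ A" "model_of L p (restr A X)"
proof -
  from assms(3) obtain u where u: "u \<in> univ A" by (auto simp: model_of_def is_struct_def)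
  have closed: "closed_under L A (univ A)" using assms(3) by (simp add: model_of_def is_struct_def)
  have "finite (free_vars p)" using assms(2) by (simp add: sentence_def)
  with u obtain H where H: "countable H" "\<forall>h\<in>H. \<forall>xs\<in>lists (univ A). h xs \<in> univ A"
    "\<forall>X e. X \<subseteq> univ A \<and> (\<forall>h\<in>H. \<forall>xs\<in>lists X. h xs \<in> X) \<and> range e \<subseteq> X \<longrightarrow>
      (sat (restr A X) e p \<longleftrightarrow> sat A e p)"
    using skolem_functions[of A p] by blast
  \<comment> \<open>Operations for the closure must accept lists of every length; off the arity of
    the symbol the value is \<open>u\<close>, which does no harm.\<close>
  define op where "op s xs = (if length xs = fun_ar L s then fint A s xs else u)" for s xs
  have "countable (H \<union> op ` funs L)" using H(1) assms(1) by simp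
  moreover have "h xs \<in> univ A" if "h \<in> H \<union> op ` funs L" "xs \<in> lists (univ A)" for h xs
    using that H(2) closed u by (auto simp: op_def closed_under_def tuples_def subset_eq)
  \<comment> \<open>\<open>u\<close> is added because \<open>S\<close> may be empty and a structure
    may not.\<close>
  ultimately obtain X where X: "countable X" "insert u S \<subseteq> X" "X \<subseteq> univ A"
    "\<And>h xs. h \<in> H \<union> op ` funs L \<Longrightarrow> xs \<in> lists X \<Longrightarrow> h xs \<in> X"
    using countable_closure_under_operations[of "H \<union> op ` funs L" "insert u S" "univ A"]
      assms(4,5) u by (metis countable_insert insert_subset)
  have "fint A s xs \<in> X" if "s \<in> funs L" "xs \<in> tuples X (fun_ar L s)" for s xs
  proof -
    have "op s xs \<in> X" using that by (intro X(4)) (auto simp: tuples_def)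
    then show ?thesis using that(2) by (simp add: op_def tuples_def)
  qed
  then have "is_struct L (restr A X)"
    using X(2) by (auto simp: is_struct_def closed_under_def)
  moreover have "sat (restr A X) e p" if "range e \<subseteq> X" for e
  proof -
    have "sat (restr A X) e p \<longleftrightarrow> sat A e p"
      by (rule H(3)[rule_format]) (use X that in auto)
    moreover have "sat A e p" using assms(3) that X(3) by (auto simp: model_of_def)
    ultimately show ?thesis by simp
  qed
  ultimately have "model_of L p (restr A X)" by (simp add: model_of_def)
  from that[OF X(1) _ X(3) this] X(2) show ?thesis by simp
qed

section \<open>Truth under isomorphism, and copies on the natural numbers\<close>

lemma tm_val_in_univ:
  assumes "closed_under L A (univ A)" "range e \<subseteq> univ A"
  shows "tm_wf L t \<Longrightarrow> tm_val A e t \<in> univ A"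
proof (induction t)
  case (App s ts)
  then have "map (tm_val A e) ts \<in> tuples (univ A) (fun_ar L s)" by (auto simp: tuples_def)
  with App.prems assms(1) show ?case by (simp add: closed_under_def)
qed (use assms in auto)

lemma tm_val_iso:
  assumes "is_iso L A B h" "closed_under L A (univ A)" "range e \<subseteq> univ A"
  shows "tm_wf L t \<Longrightarrow> tm_val B (h \<circ> e) t = h (tm_val A e t)"
proof (induction t)
  case (App s ts)
  have "map (tm_val B (h \<circ> e)) ts = map h (map (tm_val A e) ts)" using App by (simp add: comp_def)
  moreover have "map (tm_val A e) ts \<in> tuples (univ A) (fun_ar L s)"
    using App.prems tm_val_in_univ[OF assms(2,3)] by (auto simp: tuples_def)
  moreover have "s \<in> funs L" using App.prems by simp
  ultimately show ?case using assms(1) unfolding is_iso_def by (metis tm_val.simps(2))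
qed simp

text \<open>Equations use injectivity of \<open>h\<close>, the quantifier uses surjectivity. Closure
  keeps the values of terms in the universe, the only place where \<open>h\<close> is
  controlled.\<close>

lemma sat_iso:
  assumes "is_iso L A B h" "closed_under L A (univ A)"
  shows "fm_wf L p \<Longrightarrow> range e \<subseteq> univ A \<Longrightarrow> sat B (h \<circ> e) p \<longleftrightarrow> sat A e p"
proof (induction p arbitrary: e)
  case (FEq t u)
  have "inj_on h (univ A)" using assms(1) by (simp add: is_iso_def bij_betw_def)
  moreover have "tm_val A e t \<in> univ A" "tm_val A e u \<in> univ A"
    using FEq tm_val_in_univ[OF assms(2)] by auto
  ultimately show ?case using FEq tm_val_iso[OF assms FEq.prems(2)] by (simp add: inj_on_eq_iff comp_def)
next
  case (FRel R ts)
  have "map (tm_val B (h \<circ> e)) ts = map h (map (tm_val A e) ts)"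
    using FRel tm_val_iso[OF assms] by auto
  moreover have "map (tm_val A e) ts \<in> tuples (univ A) (rel_ar L R)"
    using FRel tm_val_in_univ[OF assms(2)] by (auto simp: tuples_def)
  moreover have "R \<in> rels L" using FRel by simp
  ultimately show ?case using assms(1) unfolding is_iso_def by (metis sat.simps(2))
next
  case (FEx i p)
  have im: "univ B = h ` univ A" using assms(1) by (simp add: is_iso_def bij_betw_def)
  have "sat B ((h \<circ> e)(i := h a)) p \<longleftrightarrow> sat A (e(i := a)) p" if "a \<in> univ A" for a
  proof -
    have "sat B (h \<circ> e(i := a)) p \<longleftrightarrow> sat A (e(i := a)) p"
      using FEx.prems that by (intro FEx.IH) auto
    moreover have "h \<circ> e(i := a) = (h \<circ> e)(i := h a)" by auto
    ultimately show ?thesis by simp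
  qed
  then show ?case unfolding sat.simps im by blast
qed auto

text \<open>The uniqueness clause of \<open>scott_sentence\<close> speaks of structures on natural
  numbers only, so a countable submodel has to be copied there before it can be compared with the
  limit.\<close>

lemma countable_model_has_nat_copy:
  assumes "model_of L p A" "sentence L p" "countable (univ A)"
  obtains B :: "('f, 'r, nat) struct" and h where "model_of L p B" "is_iso L B A h"
proof -
  have A: "univ A \<noteq> {}" "closed_under L A (univ A)"
    using assms(1) by (auto simp: model_of_def is_struct_def)
  obtain N :: "nat set" and t where t: "bij_betw t (univ A) N"
    using inj_on_imp_bij_betw[OF inj_on_to_nat_on[OF assms(3)]] by blast
  define h where "h = inv_into (univ A) t"
  have h: "bij_betw h N (univ A)" using t by (simp add: h_def bij_betw_inv_into)
  have ht: "h (t x) = x" if "x \<in> univ A" for x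
    using t that by (auto simp: h_def bij_betw_def)
  \<comment> \<open>All symbols are pulled back along \<open>h\<close>, so \<open>h\<close> is an
    isomorphism by construction.\<close>
  define B where "B = \<lparr>univ = N, fint = \<lambda>s xs. t (fint A s (map h xs)), rint = \<lambda>R xs. rint A R (map h xs)\<rparr>"
  have tuples: "map h xs \<in> tuples (univ A) k" if "xs \<in> tuples N k" for xs k
    using that h by (auto simp: tuples_def bij_betw_def)
  have in_A: "fint A s (map h xs) \<in> univ A" if "s \<in> funs L" "xs \<in> tuples N (fun_ar L s)" for s xs
    using that tuples A(2) by (simp add: closed_under_def)
  have iso: "is_iso L B A h" using h in_A ht by (simp add: is_iso_def B_def)
  have struct: "is_struct L B"
    using A(1) h in_A t by (auto simp: is_struct_def closed_under_def B_def bij_betw_def)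
  have "sat B e p" if "range e \<subseteq> univ B" for e
  proof -
    have "range (h \<circ> e) \<subseteq> univ A" using that h by (auto simp: B_def bij_betw_def)
    then have "sat A (h \<circ> e) p" using assms(1) by (simp add: model_of_def)
    then show ?thesis
      using sat_iso[OF iso _ _ that] struct assms(2) by (simp add: sentence_def is_struct_def)
  qed
  with struct have "model_of L p B" by (simp add: model_of_def)
  with iso that show ?thesis by blast
qed

section \<open>Cofinalities\<close>

text \<open>A cofinal map into \<open>X\<close> composed with the monotone surjection
  \<open>f\<close> is cofinal in \<open>Y\<close>. Backwards, preimages of the values themselves
  would not do, because a fibre of \<open>f\<close> can extend past a chosen preimage; preimages of
  strictly larger values do.\<close>

lemma cofinal_map_transfer:
  assumes "trans s" and no_max: "\<And>m. m \<in> Y \<Longrightarrow> \<exists>m'\<in>Y. (m, m') \<in> s"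
    and f: "f ` X = Y"
    and total: "total_on X r"
    and mono: "\<And>x x'. (x, x') \<in> r \<Longrightarrow> x \<in> X \<Longrightarrow> x' \<in> X \<Longrightarrow> f x = f x' \<or> (f x, f x') \<in> s"
    and "irrefl s"
  shows "(\<exists>g. cofinal_map r X \<kappa> g) \<longleftrightarrow> (\<exists>g. cofinal_map s Y \<kappa> g)"
proof
  assume "\<exists>g. cofinal_map r X \<kappa> g"
  then obtain g where g: "g ` Field \<kappa> \<subseteq> X" "\<forall>x\<in>X. \<exists>i\<in>Field \<kappa>. x = g i \<or> (x, g i) \<in> r"
    by (auto simp: cofinal_map_def)
  have "\<exists>i\<in>Field \<kappa>. m = f (g i) \<or> (m, f (g i)) \<in> s" if m: "m \<in> Y" for m
  proof -
    obtain x where x: "x \<in> X" "m = f x" using m f by blast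
    then obtain i where "i \<in> Field \<kappa>" "x = g i \<or> (x, g i) \<in> r" using g(2) by blast
    then show ?thesis using mono[of x "g i"] g(1) x by blast
  qed
  then have "cofinal_map s Y \<kappa> (f \<circ> g)" using g(1) f by (auto simp: cofinal_map_def)
  then show "\<exists>g. cofinal_map s Y \<kappa> g" by blast
next
  assume "\<exists>g. cofinal_map s Y \<kappa> g"
  then obtain g where g: "g ` Field \<kappa> \<subseteq> Y" "\<forall>m\<in>Y. \<exists>i\<in>Field \<kappa>. m = g i \<or> (m, g i) \<in> s"
    by (auto simp: cofinal_map_def)
  \<comment> \<open>First step strictly above \<open>g i\<close>, which is possible as
    \<open>Y\<close> has no maximum, then lift along \<open>f\<close>.\<close>
  have "\<exists>x\<in>X. (g i, f x) \<in> s" if "i \<in> Field \<kappa>" for i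
    using no_max[of "g i"] that g(1) f by blast
  then obtain k where k: "\<And>i. i \<in> Field \<kappa> \<Longrightarrow> k i \<in> X \<and> (g i, f (k i)) \<in> s" by metis
  have "\<exists>i\<in>Field \<kappa>. x = k i \<or> (x, k i) \<in> r" if x: "x \<in> X" for x
  proof -
    obtain i where i: "i \<in> Field \<kappa>" "f x = g i \<or> (f x, g i) \<in> s" using g(2) f x by blast
    then have less: "(f x, f (k i)) \<in> s" using k[OF i(1)] transD[OF \<open>trans s\<close>] by metis
    \<comment> \<open>Otherwise monotonicity would give f(k i) at most f(x), against
      \<open>less\<close>. Totality then leaves \<open>x\<close> at or below
      \<open>k i\<close>.\<close>
    have "(k i, x) \<notin> r"
    proof
      assume "(k i, x) \<in> r"
      then have "f (k i) = f x \<or> (f (k i), f x) \<in> s" using mono k i(1) x by blast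
      then have "(f x, f x) \<in> s" using less transD[OF \<open>trans s\<close>] by metis
      then show False using \<open>irrefl s\<close> by (simp add: irrefl_def)
    qed
    then show ?thesis using total k[OF i(1)] x i(1) unfolding total_on_def by blast
  qed
  then have "cofinal_map r X \<kappa> k" using k by (auto simp: cofinal_map_def)
  then show "\<exists>g. cofinal_map r X \<kappa> g" by blast
qed

text \<open>This shows that the choice in \<open>least_in\<close> is meaningful here: the identity
  on \<open>card_of X\<close> is cofinal, so there are candidates, and any nonempty set of cardinals
  has a least member.\<close>

lemma Card_order_cofinality:
  fixes X :: "'a set"
  shows "Card_order (cofinality X r)"
proof -
  define C :: "'a rel set" where "C = {\<kappa>. Card_order \<kappa> \<and> (\<exists>g. cofinal_map r X \<kappa> g)}"
  have "cofinal_map r X (card_of X) id" by (auto simp: cofinal_map_def Field_card_of)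
  with card_of_Card_order have "card_of X \<in> C" unfolding C_def by (intro CollectI conjI exI)
  then have "C \<noteq> {}" by auto
  moreover have card: "\<forall>\<kappa>\<in>C. Card_order \<kappa>" by (simp add: C_def)
  ultimately have "\<exists>\<kappa>\<in>C. \<forall>\<kappa>'\<in>C. \<kappa> \<le>o \<kappa>'" by (rule exists_minim_Card_order)
  then have "\<exists>\<kappa>. \<kappa> \<in> C \<and> (\<forall>\<kappa>'\<in>C. \<kappa> \<le>o \<kappa>')" by (simp only: Bex_def)
  from someI_ex[OF this] have "cofinality X r \<in> C"
    unfolding cofinality_def least_in_def C_def[symmetric] by (rule conjunct1)
  with card show ?thesis by (rule bspec)
qed

lemma least_in_singleton:
  assumes "Card_order \<kappa>"
  shows "least_in {\<kappa>} = \<kappa>"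
proof -
  have "\<kappa> \<le>o \<kappa>" using assms by (rule card_order_on_well_order_on[THEN ordLeq_reflexive])
  then show ?thesis unfolding least_in_def by (intro some_equality) simp_all
qed

section \<open>Isomorphisms\<close>

lemma is_iso_comp:
  assumes "is_iso L A B h" "is_iso L B C k"
  shows "is_iso L A C (k \<circ> h)"
proof -
  have t: "map h xs \<in> tuples (univ B) n" if "xs \<in> tuples (univ A) n" for xs n
    using that assms(1) by (auto simp: is_iso_def tuples_def bij_betw_def)
  have "bij_betw (k \<circ> h) (univ A) (univ C)"
    using assms by (auto simp: is_iso_def intro: bij_betw_trans)
  moreover have "(k \<circ> h) (fint A s xs) = fint C s (map (k \<circ> h) xs)"
    if "s \<in> funs L" "xs \<in> tuples (univ A) (fun_ar L s)" for s xs
    using that assms t[OF that(2)] by (simp add: is_iso_def flip: map_map)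
  moreover have "rint A R xs \<longleftrightarrow> rint C R (map (k \<circ> h) xs)"
    if "R \<in> rels L" "xs \<in> tuples (univ A) (rel_ar L R)" for R xs
    using that assms t[OF that(2)] by (simp add: is_iso_def flip: map_map)
  ultimately show ?thesis by (simp add: is_iso_def)
qed

lemma is_iso_inv:
  assumes "is_iso L A B h" "closed_under L A (univ A)"
  shows "is_iso L B A (inv_into (univ A) h)"
proof -
  let ?k = "inv_into (univ A) h"
  have h: "bij_betw h (univ A) (univ B)" using assms(1) by (simp add: is_iso_def)
  have hk: "map h (map ?k xs) = xs" if "xs \<in> tuples (univ B) n" for xs n
    using that h by (auto simp: tuples_def bij_betw_def f_inv_into_f intro!: map_idI)
  have t: "map ?k xs \<in> tuples (univ A) n" if "xs \<in> tuples (univ B) n" for xs n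
    using that bij_betw_inv_into[OF h] by (auto simp: tuples_def bij_betw_def)
  have "?k (fint B s xs) = fint A s (map ?k xs)"
    if s: "s \<in> funs L" and xs: "xs \<in> tuples (univ B) (fun_ar L s)" for s xs
  proof -
    have "h (fint A s (map ?k xs)) = fint B s (map h (map ?k xs))"
      using assms(1) s t[OF xs] by (simp add: is_iso_def del: map_map)
    then have "h (fint A s (map ?k xs)) = fint B s xs" by (simp only: hk[OF xs])
    \<comment> \<open>\<open>inv_into\<close> undoes \<open>h\<close> only inside the universe,
      hence the closure hypothesis.\<close>
    moreover have "fint A s (map ?k xs) \<in> univ A"
      using assms(2) s t[OF xs] by (simp add: closed_under_def)
    ultimately show ?thesis using h by (metis bij_betw_def inv_into_f_f)
  qed
  moreover have "rint B R xs \<longleftrightarrow> rint A R (map ?k xs)"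
    if R: "R \<in> rels L" and xs: "xs \<in> tuples (univ B) (rel_ar L R)" for R xs
  proof -
    have "rint A R (map ?k xs) \<longleftrightarrow> rint B R (map h (map ?k xs))"
      using assms(1) R t[OF xs] by (simp add: is_iso_def del: map_map)
    then show ?thesis by (simp only: hk[OF xs])
  qed
  ultimately show ?thesis using bij_betw_inv_into[OF h] by (simp add: is_iso_def)
qed

text \<open>\<open>Z\<close> may be any subset, because \<open>is_iso\<close> compares function
  values without asking that they stay in the universe.\<close>

lemma is_iso_restr:
  assumes "is_iso L A B h" "Z \<subseteq> univ A"
  shows "is_iso L (restr A Z) (restr B (h ` Z)) h"
proof -
  have "tuples Z n \<subseteq> tuples (univ A) n" for n using assms(2) by (auto simp: tuples_def)
  moreover have "inj_on h Z" using assms by (auto simp: is_iso_def bij_betw_def intro: inj_on_subset)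
  ultimately show ?thesis using assms(1) by (simp add: is_iso_def inj_on_imp_bij_betw subset_eq)
qed

section \<open>The expanded language, symbol by symbol\<close>

lemma xlang_simps [simp]:
  "OldF s \<in> funs (xlang L0) \<longleftrightarrow> s \<in> funs L0" "F_sym \<in> funs (xlang L0)"
  "OldR R \<in> rels (xlang L0) \<longleftrightarrow> R \<in> rels L0" "V_sym \<in> rels (xlang L0)" "M_sym \<in> rels (xlang L0)"
  "N_sym \<in> rels (xlang L0)" "Tri_sym \<in> rels (xlang L0)"
  "fun_ar (xlang L0) (OldF s) = fun_ar L0 s" "fun_ar (xlang L0) F_sym = 2"
  "rel_ar (xlang L0) (OldR R) = rel_ar L0 R" "rel_ar (xlang L0) V_sym = Suc 0"
  "rel_ar (xlang L0) M_sym = Suc 0" "rel_ar (xlang L0) N_sym = Suc 0" "rel_ar (xlang L0) Tri_sym = 2"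
  by (auto simp: xlang_def)

lemma ball_funs_xlang: "(\<forall>s\<in>funs (xlang L0). P s) \<longleftrightarrow> (\<forall>s\<in>funs L0. P (OldF s)) \<and> P F_sym"
  by (auto simp: xlang_def)

lemma ball_rels_xlang:
  "(\<forall>R\<in>rels (xlang L0). P R) \<longleftrightarrow>
    (\<forall>R\<in>rels L0. P (OldR R)) \<and> P V_sym \<and> P M_sym \<and> P N_sym \<and> P Tri_sym"
  by (auto simp: xlang_def)

lemma tuples_1: "xs \<in> tuples X (Suc 0) \<longleftrightarrow> (\<exists>x\<in>X. xs = [x])"
  by (auto simp: tuples_def length_Suc_conv)

lemma tuples_2: "xs \<in> tuples X 2 \<longleftrightarrow> (\<exists>x\<in>X. \<exists>y\<in>X. xs = [x, y])"
  by (auto simp: tuples_def length_Suc_conv numeral_2_eq_2)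

lemma countable_xlang: "countable_lang L0 \<Longrightarrow> countable (funs (xlang L0))"
  by (simp add: countable_lang_def xlang_def)

lemma is_iso_xlang_elim:
  assumes "is_iso (xlang L0) A B h"
  shows "h ` univ A = univ B" "inj_on h (univ A)"
    "\<And>x y. x \<in> univ A \<Longrightarrow> y \<in> univ A \<Longrightarrow> ff B (h x) (h y) = h (ff A x y)"
    "\<And>x. x \<in> univ A \<Longrightarrow> rint B V_sym [h x] \<longleftrightarrow> rint A V_sym [x]"
    "\<And>x. x \<in> univ A \<Longrightarrow> rint B M_sym [h x] \<longleftrightarrow> rint A M_sym [x]"
    "\<And>x. x \<in> univ A \<Longrightarrow> rint B N_sym [h x] \<longleftrightarrow> rint A N_sym [x]"
    "\<And>x y. x \<in> univ A \<Longrightarrow> y \<in> univ A \<Longrightarrow> rint B Tri_sym [h x, h y] \<longleftrightarrow> rint A Tri_sym [x, y]"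
    "\<And>R x y. R \<in> rels L0 \<Longrightarrow> rel_ar L0 R = 2 \<Longrightarrow> x \<in> univ A \<Longrightarrow> y \<in> univ A \<Longrightarrow>
      rint B (OldR R) [h x, h y] \<longleftrightarrow> rint A (OldR R) [x, y]"
  using assms unfolding is_iso_def ball_funs_xlang ball_rels_xlang
  by (auto simp: bij_betw_def tuples_1 tuples_2)

lemma is_iso_xlang_restrI:
  assumes "bij_betw h X Y"
    "\<And>s xs. s \<in> funs L0 \<Longrightarrow> xs \<in> tuples X (fun_ar L0 s) \<Longrightarrow>
      h (fint A (OldF s) xs) = fint B (OldF s) (map h xs)"
    "\<And>R xs. R \<in> rels L0 \<Longrightarrow> xs \<in> tuples X (rel_ar L0 R) \<Longrightarrow>
      rint A (OldR R) xs \<longleftrightarrow> rint B (OldR R) (map h xs)"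
    "\<And>x y. x \<in> X \<Longrightarrow> y \<in> X \<Longrightarrow> h (ff A x y) = ff B (h x) (h y)"
    "\<And>x y. x \<in> X \<Longrightarrow> y \<in> X \<Longrightarrow> rint A Tri_sym [x, y] \<longleftrightarrow> rint B Tri_sym [h x, h y]"
    "\<And>x. x \<in> X \<Longrightarrow> rint A V_sym [x] \<longleftrightarrow> rint B V_sym [h x]"
    "\<And>x. x \<in> X \<Longrightarrow> rint A M_sym [x] \<longleftrightarrow> rint B M_sym [h x]"
    "\<And>x. x \<in> X \<Longrightarrow> rint A N_sym [x] \<longleftrightarrow> rint B N_sym [h x]"
  shows "is_iso (xlang L0) (restr A X) (restr B Y) h"
  using assms unfolding is_iso_def ball_funs_xlang ball_rels_xlang
  by (auto simp: tuples_1 tuples_2)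

lemma parts_iso:
  assumes "is_iso (xlang L0) A B h"
  shows "Vpart B = h ` Vpart A" "Mpart B = h ` Mpart A"
  using is_iso_xlang_elim(4,5)[OF assms]
  by (auto simp: Vpart_def Mpart_def simp flip: is_iso_xlang_elim(1)[OF assms])

lemma parts_restr:
  "Vpart (restr A X) = Vpart A \<inter> X" "Mpart (restr A X) = Mpart A \<inter> X"
  "Npart (restr A X) = Npart A \<inter> X"
  if "X \<subseteq> univ A"
  using that by (auto simp: Vpart_def Mpart_def Npart_def)

lemma rel_on_restr [simp]: "rel_on (restr A X) = rel_on A"
  by (intro ext) (simp add: rel_on_def)

section \<open>The axioms that determine the characters\<close>

text \<open>
  Every clause is a universal-existential condition with at most three universal quantifiers, so it
  passes from substructures containing prescribed triples to the whole structure.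
\<close>

definition V_axioms :: "'r \<Rightarrow> ('f, 'r, 'a) xstruct \<Rightarrow> bool" where
  "V_axioms lt A \<longleftrightarrow>
     Vpart A \<noteq> {} \<and>
     strict_linear_order_on (Vpart A) (tri A) \<and>
     strict_linear_order_on (Mpart A) (less_M lt A) \<and>
     (\<forall>m\<in>Mpart A. \<exists>m'\<in>Mpart A. (m, m') \<in> less_M lt A) \<and>
     (\<forall>x\<in>Vpart A. \<forall>y\<in>Vpart A. x \<noteq> y \<longrightarrow> ff A x y \<in> Mpart A) \<and>
     (\<forall>x\<in>Vpart A. \<forall>y\<in>Vpart A. \<forall>z\<in>Vpart A. (x, y) \<in> tri A \<and> (y, z) \<in> tri A \<longrightarrow>
        (ff A x y = ff A x z \<and> ff A x z = ff A y z) \<or>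
        (ff A x y = ff A x z \<and> (ff A x z, ff A y z) \<in> less_M lt A) \<or>
        (ff A x z = ff A y z \<and> (ff A y z, ff A x y) \<in> less_M lt A)) \<and>
     (\<forall>x\<in>Vpart A. \<forall>m\<in>Mpart A.
        (\<exists>y\<in>Vpart A. (y, x) \<in> tri A \<and> ff A y x = m) \<and>
        (\<exists>y\<in>Vpart A. (x, y) \<in> tri A \<and> ff A x y = m))"

text \<open>\<open>trans\<close> quantifies over the whole type. Bounding all variables by
  \<open>X\<close> gives conditions on at most three elements of \<open>X\<close>, the form in which
  they can be localised and transported.\<close>

lemma strict_linear_order_on_rel_on:
  "strict_linear_order_on X (rel_on A R X) \<longleftrightarrow>
     (\<forall>x\<in>X. \<forall>y\<in>X. \<forall>z\<in>X. (x, y) \<in> rel_on A R X \<longrightarrow> (y, z) \<in> rel_on A R X \<longrightarrow> (x, z) \<in> rel_on A R X) \<and>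
     (\<forall>x\<in>X. (x, x) \<notin> rel_on A R X) \<and>
     (\<forall>x\<in>X. \<forall>y\<in>X. x \<noteq> y \<longrightarrow> (x, y) \<in> rel_on A R X \<or> (y, x) \<in> rel_on A R X)"
  unfolding strict_linear_order_on_def trans_def irrefl_def total_on_def rel_on_def by blast

lemma V_axiomsD:
  assumes "V_axioms lt A"
  shows "Vpart A \<noteq> {}"
    "trans (tri A)" "irrefl (tri A)" "total_on (Vpart A) (tri A)"
    "trans (less_M lt A)" "irrefl (less_M lt A)" "total_on (Mpart A) (less_M lt A)"
    "\<And>m. m \<in> Mpart A \<Longrightarrow> \<exists>m'\<in>Mpart A. (m, m') \<in> less_M lt A"
    "\<And>x y. x \<in> Vpart A \<Longrightarrow> y \<in> Vpart A \<Longrightarrow> x \<noteq> y \<Longrightarrow> ff A x y \<in> Mpart A"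
    "\<And>x y z. (x, y) \<in> tri A \<Longrightarrow> (y, z) \<in> tri A \<Longrightarrow>
        (ff A x y = ff A x z \<and> ff A x z = ff A y z) \<or>
        (ff A x y = ff A x z \<and> (ff A x z, ff A y z) \<in> less_M lt A) \<or>
        (ff A x z = ff A y z \<and> (ff A y z, ff A x y) \<in> less_M lt A)"
    "\<And>x m. x \<in> Vpart A \<Longrightarrow> m \<in> Mpart A \<Longrightarrow> \<exists>y\<in>Vpart A. (y, x) \<in> tri A \<and> ff A y x = m"
    "\<And>x m. x \<in> Vpart A \<Longrightarrow> m \<in> Mpart A \<Longrightarrow> \<exists>y\<in>Vpart A. (x, y) \<in> tri A \<and> ff A x y = m"
    "\<And>x y. (x, y) \<in> tri A \<Longrightarrow> ff A x y \<in> Mpart A"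
proof -
  note ax = assms[unfolded V_axioms_def strict_linear_order_on_def]
  have V: "x \<in> Vpart A \<and> y \<in> Vpart A" if "(x, y) \<in> tri A" for x y
    using that by (simp add: rel_on_def)
  show nonempty: "Vpart A \<noteq> {}" and tri: "trans (tri A)" "irrefl (tri A)" "total_on (Vpart A) (tri A)"
    and less: "trans (less_M lt A)" "irrefl (less_M lt A)" "total_on (Mpart A) (less_M lt A)"
    unfolding atomize_conj using ax by (elim conjE) (intro conjI)
  show "\<And>m. m \<in> Mpart A \<Longrightarrow> \<exists>m'\<in>Mpart A. (m, m') \<in> less_M lt A"
    using ax by (elim conjE) (erule bspec)
  show ff: "ff A x y \<in> Mpart A" if "x \<in> Vpart A" "y \<in> Vpart A" "x \<noteq> y" for x y
  proof -
    have "\<forall>x\<in>Vpart A. \<forall>y\<in>Vpart A. x \<noteq> y \<longrightarrow> ff A x y \<in> Mpart A" using ax by (elim conjE)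
    with that show ?thesis by blast
  qed
  show "ff A x y \<in> Mpart A" if "(x, y) \<in> tri A" for x y
    using ff V[OF that] tri(2) that by (metis irreflD)
  show "(ff A x y = ff A x z \<and> ff A x z = ff A y z) \<or>
        (ff A x y = ff A x z \<and> (ff A x z, ff A y z) \<in> less_M lt A) \<or>
        (ff A x z = ff A y z \<and> (ff A y z, ff A x y) \<in> less_M lt A)"
    if "(x, y) \<in> tri A" "(y, z) \<in> tri A" for x y z
  proof -
    have "\<forall>x\<in>Vpart A. \<forall>y\<in>Vpart A. \<forall>z\<in>Vpart A. (x, y) \<in> tri A \<and> (y, z) \<in> tri A \<longrightarrow>
        (ff A x y = ff A x z \<and> ff A x z = ff A y z) \<or>
        (ff A x y = ff A x z \<and> (ff A x z, ff A y z) \<in> less_M lt A) \<or>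
        (ff A x z = ff A y z \<and> (ff A y z, ff A x y) \<in> less_M lt A)"
      using ax by (elim conjE)
    then show ?thesis using that V[OF that(1)] V[OF that(2)] by simp
  qed
  have ext: "\<forall>x\<in>Vpart A. \<forall>m\<in>Mpart A. (\<exists>y\<in>Vpart A. (y, x) \<in> tri A \<and> ff A y x = m) \<and>
      (\<exists>y\<in>Vpart A. (x, y) \<in> tri A \<and> ff A x y = m)"
    using ax by (elim conjE)
  show "\<exists>y\<in>Vpart A. (y, x) \<in> tri A \<and> ff A y x = m" "\<exists>y\<in>Vpart A. (x, y) \<in> tri A \<and> ff A x y = m"
    if "x \<in> Vpart A" "m \<in> Mpart A" for x m
    using ext that by blast+
qed

lemma V_axioms_iso:
  fixes A :: "('f, 'r, 'a) xstruct" and B :: "('f, 'r, 'b) xstruct"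
  assumes iso: "is_iso (xlang L0) A B h" and lt: "lt \<in> rels L0" "rel_ar L0 lt = 2"
    and A: "V_axioms lt A"
  shows "V_axioms lt B"
proof -
  note h = is_iso_xlang_elim[OF iso]
  note V = parts_iso(1)[OF iso] and M = parts_iso(2)[OF iso]
  have VA: "Vpart A \<subseteq> univ A" and MA: "Mpart A \<subseteq> univ A" by (auto simp: Vpart_def Mpart_def)
  have tri: "(h x, h y) \<in> tri B \<longleftrightarrow> (x, y) \<in> tri A" if "x \<in> Vpart A" "y \<in> Vpart A" for x y
    using that VA h(7) by (auto simp: rel_on_def V)
  have less: "(h x, h y) \<in> less_M lt B \<longleftrightarrow> (x, y) \<in> less_M lt A" if "x \<in> Mpart A" "y \<in> Mpart A" for x y
    using that MA h(8)[OF lt] by (auto simp: rel_on_def M)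
  have ffB: "ff B (h x) (h y) = h (ff A x y)" if "x \<in> Vpart A" "y \<in> Vpart A" for x y
    using that VA h(3) by blast
  note ax = V_axiomsD[OF A] and tri' = tri[unfolded V] and less' = less[unfolded M]
  have cond: "(ff B (h x) (h y) = ff B (h x) (h z) \<and> ff B (h x) (h z) = ff B (h y) (h z)) \<or>
        (ff B (h x) (h y) = ff B (h x) (h z) \<and> (ff B (h x) (h z), ff B (h y) (h z)) \<in> less_M lt B) \<or>
        (ff B (h x) (h z) = ff B (h y) (h z) \<and> (ff B (h y) (h z), ff B (h x) (h y)) \<in> less_M lt B)"
    if V: "x \<in> Vpart A" "y \<in> Vpart A" "z \<in> Vpart A" and xyz: "(x, y) \<in> tri A" "(y, z) \<in> tri A" for x y z
  proof -
    have "(x, z) \<in> tri A" using ax(2) xyz by (rule transD)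
    \<comment> \<open>\<open>less\<close> compares elements of the M-part only, so the three values
      have to be placed there first.\<close>
    note fM = ax(13)[OF xyz(1)] ax(13)[OF xyz(2)] ax(13)[OF this]
    show ?thesis
      using ax(10)[OF xyz]
      unfolding ffB[OF V(1,2)] ffB[OF V(1,3)] ffB[OF V(2,3)]
        less[OF fM(3,2)] less[OF fM(2,1)]
      by metis
  qed
  have ext: "(\<exists>y\<in>Vpart A. (h y, h x) \<in> tri B \<and> ff B (h y) (h x) = h m) \<and>
      (\<exists>y\<in>Vpart A. (h x, h y) \<in> tri B \<and> ff B (h x) (h y) = h m)"
    if xm: "x \<in> Vpart A" "m \<in> Mpart A" for x m
  proof -
    obtain y z where "y \<in> Vpart A" "(y, x) \<in> tri A" "ff A y x = m"
      "z \<in> Vpart A" "(x, z) \<in> tri A" "ff A x z = m"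
      using ax(11,12)[OF xm] by blast
    then show ?thesis using xm tri ffB by metis
  qed
  have "strict_linear_order_on (Vpart B) (tri B)"
    unfolding strict_linear_order_on_rel_on
  proof (intro conjI)
    show "\<forall>x\<in>Vpart B. \<forall>y\<in>Vpart B. \<forall>z\<in>Vpart B. (x, y) \<in> tri B \<longrightarrow> (y, z) \<in> tri B \<longrightarrow> (x, z) \<in> tri B"
      using ax(2) by (auto simp: V tri' dest: transD)
    show "\<forall>x\<in>Vpart B. (x, x) \<notin> tri B" using ax(3) by (auto simp: V tri' irrefl_def)
    show "\<forall>x\<in>Vpart B. \<forall>y\<in>Vpart B. x \<noteq> y \<longrightarrow> (x, y) \<in> tri B \<or> (y, x) \<in> tri B"
      using ax(4) by (auto simp: V tri' total_on_def)
  qed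
  moreover have "strict_linear_order_on (Mpart B) (less_M lt B)"
    unfolding strict_linear_order_on_rel_on
  proof (intro conjI)
    show "\<forall>x\<in>Mpart B. \<forall>y\<in>Mpart B. \<forall>z\<in>Mpart B.
        (x, y) \<in> less_M lt B \<longrightarrow> (y, z) \<in> less_M lt B \<longrightarrow> (x, z) \<in> less_M lt B"
      using ax(5) by (auto simp: M less' dest: transD)
    show "\<forall>x\<in>Mpart B. (x, x) \<notin> less_M lt B" using ax(6) by (auto simp: M less' irrefl_def)
    show "\<forall>x\<in>Mpart B. \<forall>y\<in>Mpart B. x \<noteq> y \<longrightarrow> (x, y) \<in> less_M lt B \<or> (y, x) \<in> less_M lt B"
      using ax(7) by (auto simp: M less' total_on_def)
  qed
  moreover have "\<forall>m\<in>Mpart B. \<exists>m'\<in>Mpart B. (m, m') \<in> less_M lt B"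
    using ax(8) by (auto simp: M less')
  moreover have "\<forall>x\<in>Vpart B. \<forall>y\<in>Vpart B. x \<noteq> y \<longrightarrow> ff B x y \<in> Mpart B"
    using ax(9) by (auto simp: V M ffB)
  moreover have "Vpart B \<noteq> {}" using ax(1) V by simp
  ultimately show ?thesis
    unfolding V_axioms_def using cond[unfolded M] ext[unfolded V] by (simp add: V M tri')
qed

text \<open>The relations of a substructure are the traces of those of \<open>A\<close>. The
  premises of a clause at a given triple descend to \<open>X\<close> by \<open>tri\<close> and
  \<open>less\<close>; conclusions and witnesses come back up by \<open>sub\<close>.\<close>

lemma V_axioms_local:
  fixes A :: "('f, 'r, 'a) xstruct"
  assumes local: "\<And>x y z. {x, y, z} \<subseteq> univ A \<Longrightarrow>
      \<exists>X \<subseteq> univ A. {x, y, z} \<subseteq> X \<and> V_axioms lt (restr A X)"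
    and "univ A \<noteq> {}"
  shows "V_axioms lt A"
proof -
  have VA: "Vpart A \<subseteq> univ A" and MA: "Mpart A \<subseteq> univ A" by (auto simp: Vpart_def Mpart_def)
  have sub: "tri (restr A X) \<subseteq> tri A" "less_M lt (restr A X) \<subseteq> less_M lt A"
    "Vpart (restr A X) \<subseteq> Vpart A" "Mpart (restr A X) \<subseteq> Mpart A" if "X \<subseteq> univ A" for X
    using that by (auto simp: parts_restr rel_on_def)
  have tri: "(x, y) \<in> tri (restr A X)" if "(x, y) \<in> tri A" "x \<in> X" "y \<in> X" "X \<subseteq> univ A" for x y X
    using that by (simp add: parts_restr rel_on_def)
  have less: "(x, y) \<in> less_M lt (restr A X)" if "(x, y) \<in> less_M lt A" "x \<in> X" "y \<in> X" "X \<subseteq> univ A"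
    for x y X
    using that by (simp add: parts_restr rel_on_def)
  \<comment> \<open>That the V-part is nonempty is the one clause about no given element, so an
    arbitrary \<open>u\<close> supplies some \<open>X\<close>.\<close>
  from \<open>univ A \<noteq> {}\<close> obtain u where "u \<in> univ A" by blast
  then obtain X where "X \<subseteq> univ A" "V_axioms lt (restr A X)" using local[of u u u] by blast
  then have nonempty: "Vpart A \<noteq> {}" by (auto simp: V_axioms_def parts_restr)
  have V: "(x, y) \<in> tri A \<longrightarrow> (y, z) \<in> tri A \<longrightarrow> (x, z) \<in> tri A" "(x, x) \<notin> tri A"
      "x \<noteq> y \<longrightarrow> (x, y) \<in> tri A \<or> (y, x) \<in> tri A" "x \<noteq> y \<longrightarrow> ff A x y \<in> Mpart A"
      "(x, y) \<in> tri A \<and> (y, z) \<in> tri A \<longrightarrow>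
        (ff A x y = ff A x z \<and> ff A x z = ff A y z) \<or>
        (ff A x y = ff A x z \<and> (ff A x z, ff A y z) \<in> less_M lt A) \<or>
        (ff A x z = ff A y z \<and> (ff A y z, ff A x y) \<in> less_M lt A)"
    if "x \<in> Vpart A" "y \<in> Vpart A" "z \<in> Vpart A" for x y z
  proof -
    have "{x, y, z} \<subseteq> univ A" using that VA by blast
    from local[OF this] obtain X where X: "X \<subseteq> univ A" "{x, y, z} \<subseteq> X" "V_axioms lt (restr A X)"
      by blast
    note D = V_axiomsD[OF X(3), unfolded fint_restr] and sub = sub[OF X(1)]
    have mem: "x \<in> X" "y \<in> X" "z \<in> X" using X(2) by auto
    have xyz: "x \<in> Vpart (restr A X)" "y \<in> Vpart (restr A X)" using that mem X(1) by (auto simp: parts_restr)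
    show "(x, y) \<in> tri A \<longrightarrow> (y, z) \<in> tri A \<longrightarrow> (x, z) \<in> tri A"
      using transD[OF D(2), of x y z] tri[OF _ _ _ X(1)] mem sub(1) by blast
    show "(x, x) \<notin> tri A" using irreflD[OF D(3), of x] tri[OF _ _ _ X(1)] mem by blast
    show "x \<noteq> y \<longrightarrow> (x, y) \<in> tri A \<or> (y, x) \<in> tri A"
      using D(4) xyz sub(1) unfolding total_on_def by blast
    show "x \<noteq> y \<longrightarrow> ff A x y \<in> Mpart A" using D(9)[OF xyz] sub(4) by blast
    show "(x, y) \<in> tri A \<and> (y, z) \<in> tri A \<longrightarrow>
        (ff A x y = ff A x z \<and> ff A x z = ff A y z) \<or>
        (ff A x y = ff A x z \<and> (ff A x z, ff A y z) \<in> less_M lt A) \<or>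
        (ff A x z = ff A y z \<and> (ff A y z, ff A x y) \<in> less_M lt A)"
      using D(10)[of x y z] tri[OF _ mem(1,2) X(1)] tri[OF _ mem(2,3) X(1)] subsetD[OF sub(2)] by metis
  qed
  have M: "(x, y) \<in> less_M lt A \<longrightarrow> (y, z) \<in> less_M lt A \<longrightarrow> (x, z) \<in> less_M lt A"
      "(x, x) \<notin> less_M lt A" "x \<noteq> y \<longrightarrow> (x, y) \<in> less_M lt A \<or> (y, x) \<in> less_M lt A"
      "\<exists>m\<in>Mpart A. (x, m) \<in> less_M lt A"
    if "x \<in> Mpart A" "y \<in> Mpart A" "z \<in> Mpart A" for x y z
  proof -
    have "{x, y, z} \<subseteq> univ A" using that MA by blast
    from local[OF this] obtain X where X: "X \<subseteq> univ A" "{x, y, z} \<subseteq> X" "V_axioms lt (restr A X)"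
      by blast
    note D = V_axiomsD[OF X(3), unfolded fint_restr] and sub = sub[OF X(1)]
    have mem: "x \<in> X" "y \<in> X" "z \<in> X" using X(2) by auto
    have xyz: "x \<in> Mpart (restr A X)" "y \<in> Mpart (restr A X)" using that mem X(1) by (auto simp: parts_restr)
    show "(x, y) \<in> less_M lt A \<longrightarrow> (y, z) \<in> less_M lt A \<longrightarrow> (x, z) \<in> less_M lt A"
      using transD[OF D(5), of x y z] less[OF _ _ _ X(1)] mem sub(2) by blast
    show "(x, x) \<notin> less_M lt A" using irreflD[OF D(6), of x] less[OF _ _ _ X(1)] mem by blast
    show "x \<noteq> y \<longrightarrow> (x, y) \<in> less_M lt A \<or> (y, x) \<in> less_M lt A"
      using D(7) xyz sub(2) unfolding total_on_def by blast
    show "\<exists>m\<in>Mpart A. (x, m) \<in> less_M lt A" using D(8)[OF xyz(1)] sub(2,4) by blast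
  qed
  have ext: "(\<exists>y\<in>Vpart A. (y, x) \<in> tri A \<and> ff A y x = m) \<and>
      (\<exists>y\<in>Vpart A. (x, y) \<in> tri A \<and> ff A x y = m)"
    if "x \<in> Vpart A" "m \<in> Mpart A" for x m
  proof -
    have "{x, m, m} \<subseteq> univ A" using that VA MA by blast
    from local[OF this] obtain X where X: "X \<subseteq> univ A" "{x, m, m} \<subseteq> X" "V_axioms lt (restr A X)"
      by blast
    note D = V_axiomsD[OF X(3), unfolded fint_restr] and sub = sub[OF X(1)]
    have xm: "x \<in> Vpart (restr A X)" "m \<in> Mpart (restr A X)" using that X by (auto simp: parts_restr)
    show ?thesis using D(11,12)[OF xm] sub(1,3) by blast
  qed
  show ?thesis
    unfolding V_axioms_def strict_linear_order_on_rel_on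
    by (intro conjI ballI nonempty; (rule V M ext[THEN conjunct1] ext[THEN conjunct2]; assumption))
qed

section \<open>The limit realizes every value on both sides of a point\<close>

definition mcode :: "('f, 'r, 'm) struct \<Rightarrow> 'm \<Rightarrow> nat" where
  "mcode M v = to_nat_on (univ M) v + 2"

definition mdecode :: "('f, 'r, 'm) struct \<Rightarrow> nat \<Rightarrow> 'm" where
  "mdecode M n = from_nat_into (univ M) (n - 2)"

lemma mdecode_mcode [simp]: "countable (univ M) \<Longrightarrow> v \<in> univ M \<Longrightarrow> mdecode M (mcode M v) = v"
  by (simp add: mdecode_def mcode_def)

lemma mcode_neq [simp]: "mcode M v \<noteq> 0" "mcode M v \<noteq> Suc 0" "0 \<noteq> mcode M v" "Suc 0 \<noteq> mcode M v"
  by (simp_all add: mcode_def)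

text \<open>
  The member of the class with two points \<open>0\<close> and \<open>1\<close> in its \<open>V\<close>-part, in this order, at value \<open>m\<close>; \<open>p\<close>
  decides whether both of them satisfy \<open>N\<close>.  The \<open>M\<close>-part is coded by the naturals from \<open>2\<close> on.
\<close>

definition two_point :: "('f, 'r, 'm) struct \<Rightarrow> bool \<Rightarrow> 'm \<Rightarrow> ('f, 'r, nat) xstruct" where
  "two_point M p m = (let T = mcode M ` univ M in \<lparr>
     univ = {0, 1} \<union> T,
     fint = case_xfun
       (\<lambda>s xs. if set xs \<subseteq> T then mcode M (fint M s (map (mdecode M) xs)) else hd xs)
       (\<lambda>xs. if set xs = {0, 1} then mcode M m else hd xs),
     rint = case_xrel
       (\<lambda>R xs. set xs \<subseteq> T \<and> rint M R (map (mdecode M) xs))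
       (\<lambda>xs. set xs \<subseteq> {0, 1}) (\<lambda>xs. set xs \<subseteq> T) (\<lambda>xs. set xs \<subseteq> {0, 1} \<and> p) (\<lambda>xs. xs = [0, 1])\<rparr>)"

lemma two_point_simps [simp]:
  "univ (two_point M p m) = {0, 1} \<union> mcode M ` univ M"
  "fint (two_point M p m) (OldF s) xs =
     (if set xs \<subseteq> mcode M ` univ M then mcode M (fint M s (map (mdecode M) xs)) else hd xs)"
  "fint (two_point M p m) F_sym xs = (if set xs = {0, 1} then mcode M m else hd xs)"
  "rint (two_point M p m) (OldR R) xs \<longleftrightarrow>
     set xs \<subseteq> mcode M ` univ M \<and> rint M R (map (mdecode M) xs)"
  "rint (two_point M p m) V_sym xs \<longleftrightarrow> set xs \<subseteq> {0, 1}"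
  "rint (two_point M p m) M_sym xs \<longleftrightarrow> set xs \<subseteq> mcode M ` univ M"
  "rint (two_point M p m) N_sym xs \<longleftrightarrow> set xs \<subseteq> {0, 1} \<and> p"
  "rint (two_point M p m) Tri_sym xs \<longleftrightarrow> xs = [0, 1]"
  by (simp_all add: two_point_def Let_def)

lemma two_point_parts:
  "Vpart (two_point M p m) = {0, 1}" "Mpart (two_point M p m) = mcode M ` univ M"
  by (auto simp: Vpart_def Mpart_def)

lemma two_point_in_K:
  assumes M: "is_struct L0 M" "countable (univ M)" and m: "m \<in> univ M"
  shows "in_K L0 lt M (two_point M p m)"
proof -
  let ?B = "two_point M p m" and ?T = "mcode M ` univ M"
  have dec: "map (mdecode M) xs \<in> tuples (univ M) n" if "xs \<in> tuples ?T n" for xs n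
    using that M(2) by (auto simp: tuples_def)
  have fint_T: "fint M s (map (mdecode M) xs) \<in> univ M"
    if "s \<in> funs L0" "xs \<in> tuples ?T (fun_ar L0 s)" for s xs
    using M(1) that dec by (simp add: is_struct_def closed_under_def)
  \<comment> \<open>A list not contained in \<open>Y\<close> is nonempty, so its head really is one
    of its entries.\<close>
  have hd_in: "hd xs \<in> X" if "xs \<in> tuples X n" "\<not> set xs \<subseteq> Y" for xs :: "nat list" and X Y n
    using that by (cases xs) (auto simp: tuples_def)
  have T: "xs \<in> tuples ?T n" if "xs \<in> tuples X n" "set xs \<subseteq> ?T" for xs X n
    using that by (simp add: tuples_def)
  have "fint ?B (OldF s) xs \<in> univ ?B"
    if "s \<in> funs L0" "xs \<in> tuples (univ ?B) (fun_ar L0 s)" for s xs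
    using fint_T[OF that(1) T[OF that(2)]] hd_in[OF that(2)] by (cases "set xs \<subseteq> ?T") auto
  moreover have "fint ?B F_sym xs \<in> univ ?B" if "xs \<in> tuples (univ ?B) 2" for xs
    using that m by (auto simp: tuples_2)
  ultimately have "closed_under (xlang L0) ?B (univ ?B)"
    unfolding closed_under_def ball_funs_xlang xlang_simps by blast
  then have "is_struct (xlang L0) ?B" by (simp add: is_struct_def)
  moreover have "countable (univ ?B)" using M(2) by simp
  moreover have "trivial_off_domain L0 ?B"
    unfolding trivial_off_domain_def two_point_parts
  proof (intro conjI ballI impI)
    show "ff ?B x y = x" if "\<not> (x \<in> {0, 1} \<and> y \<in> {0, 1} \<and> x \<noteq> y)" for x y
      using that by (auto simp: doubleton_eq_iff)
  qed auto
  moreover have "is_struct L0 (Mstruct ?B)"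
    using M(1) fint_T by (auto simp: is_struct_def closed_under_def Mstruct_def two_point_parts tuples_def)
  moreover have "is_iso L0 (Mstruct ?B) M (mdecode M)"
    using M(2) fint_T
    by (auto simp: is_iso_def Mstruct_def two_point_parts tuples_def bij_betw_def inj_on_def image_image)
  then have "isomorphic L0 (Mstruct ?B) M" by (auto simp: isomorphic_def)
  moreover have "strict_linear_order_on (Vpart ?B) (tri ?B)"
    by (auto simp: two_point_parts strict_linear_order_on_def trans_def irrefl_def total_on_def rel_on_def)
  moreover have "Npart ?B \<subseteq> Vpart ?B" by (auto simp: Npart_def two_point_parts)
  \<comment> \<open>With two V-points there is no chain of three, so the condition on triples is
    vacuous.\<close>
  ultimately show ?thesis
    unfolding in_K_def using m by (auto simp: two_point_parts rel_on_def)
qed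

section \<open>One-point and two-point substructures of the limit\<close>

lemma fraisse_in_K:
  assumes F: "fraisse_limit L0 lt M F" and A0: "finite A0" "A0 \<subseteq> univ F"
  obtains X where "X \<subseteq> univ F" "A0 \<subseteq> X" "Mpart F \<subseteq> X" "in_K L0 lt M (restr F X)"
proof -
  \<comment> \<open>The whole M-part is adjoined, so restricting to this set leaves the M-part
    unchanged.\<close>
  let ?X = "generated (xlang L0) F A0 \<union> Mpart F"
  have "closed_under (xlang L0) F (univ F)" using F by (simp add: fraisse_limit_def is_struct_def)
  then have "?X \<subseteq> univ F" using A0 by (auto simp: generated_def Mpart_def)
  moreover have "A0 \<subseteq> ?X" by (auto simp: generated_def)
  moreover have "fin_gen_over (xlang L0) F (Mpart F) ?X" using A0 by (auto simp: fin_gen_over_def)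
  then have "in_K L0 lt M (restr F ?X)" using F by (simp add: fraisse_limit_def)
  ultimately show ?thesis using that by blast
qed

text \<open>The conventions of the class are known for finitely generated substructures only, so
  each fact is read off in a member of the class around \<open>x\<close>. Together they say that,
  beyond the structure on the M-part, \<open>x\<close> carries a single bit of information: whether
  N holds of it.\<close>

lemma fraisse_point:
  assumes F: "fraisse_limit L0 lt M F" and x: "x \<in> Vpart F"
  shows "x \<notin> Mpart F" "\<not> rint F Tri_sym [x, x]"
    "\<And>R xs. R \<in> rels L0 \<Longrightarrow> xs \<in> tuples (insert x (Mpart F)) (rel_ar L0 R) \<Longrightarrow>
      rint F (OldR R) xs \<Longrightarrow> set xs \<subseteq> Mpart F"
    "\<And>s xs. s \<in> funs L0 \<Longrightarrow> xs \<in> tuples (insert x (Mpart F)) (fun_ar L0 s) \<Longrightarrow>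
      \<not> set xs \<subseteq> Mpart F \<Longrightarrow> fint F (OldF s) xs = hd xs"
    "\<And>y z. y \<in> insert x (Mpart F) \<Longrightarrow> z \<in> insert x (Mpart F) \<Longrightarrow> \<not> rint F Tri_sym [y, z]"
    "\<And>y z. y \<in> insert x (Mpart F) \<Longrightarrow> z \<in> insert x (Mpart F) \<Longrightarrow> ff F y z = y"
    "\<And>y. y \<in> Mpart F \<Longrightarrow> \<not> rint F N_sym [y]" "\<And>y. y \<in> Mpart F \<Longrightarrow> y \<notin> Vpart F"
proof -
  have "finite {x}" "{x} \<subseteq> univ F" using x by (auto simp: Vpart_def)
  from fraisse_in_K[OF F this] obtain X
    where X: "X \<subseteq> univ F" "{x} \<subseteq> X" "Mpart F \<subseteq> X" "in_K L0 lt M (restr F X)" .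
  have parts: "Mpart (restr F X) = Mpart F" "x \<in> Vpart (restr F X)"
    using X x by (auto simp: parts_restr)
  have K: "trivial_off_domain L0 (restr F X)" "Vpart (restr F X) \<inter> Mpart (restr F X) = {}"
    "strict_linear_order_on (Vpart (restr F X)) (tri (restr F X))"
    "Npart (restr F X) \<subseteq> Vpart (restr F X)"
    using X(4) by (simp_all add: in_K_def)
  have sub: "tuples (insert x (Mpart F)) n \<subseteq> tuples X n" for n
    using X(2,3) by (auto simp: tuples_def)
  have disj: "y \<notin> Vpart F" if "y \<in> Mpart F" for y
    using K(2) that X(1,3) by (auto simp: parts_restr)
  show xM: "x \<notin> Mpart F" using disj x by blast
  show irr: "\<not> rint F Tri_sym [x, x]"
    using K(3) parts(2) by (auto simp: strict_linear_order_on_def irrefl_def rel_on_def)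
  note off = K(1)[unfolded trivial_off_domain_def parts univ_restr fint_restr rint_restr, THEN conjunct1]
    K(1)[unfolded trivial_off_domain_def parts univ_restr fint_restr rint_restr, THEN conjunct2, THEN conjunct1]
    K(1)[unfolded trivial_off_domain_def univ_restr fint_restr rint_restr, THEN conjunct2, THEN conjunct2]
  show "set xs \<subseteq> Mpart F" if "R \<in> rels L0" "xs \<in> tuples (insert x (Mpart F)) (rel_ar L0 R)"
    "rint F (OldR R) xs" for R xs
    using off(1) that sub by blast
  show "fint F (OldF s) xs = hd xs" if "s \<in> funs L0" "xs \<in> tuples (insert x (Mpart F)) (fun_ar L0 s)"
    "\<not> set xs \<subseteq> Mpart F" for s xs
    using off(2) that sub by blast
  have V: "y = x" if "y \<in> insert x (Mpart F)" "y \<in> Vpart (restr F X)" for y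
    using that K(2) parts by blast
  show "\<not> rint F Tri_sym [y, z]" if "y \<in> insert x (Mpart F)" "z \<in> insert x (Mpart F)" for y z
  proof
    assume yz: "rint F Tri_sym [y, z]"
    have "y \<in> X" "z \<in> X" using that X(2,3) by auto
    then have "y \<in> Vpart (restr F X)" "z \<in> Vpart (restr F X)" using off(3) yz by blast+
    then show False using V that irr yz by metis
  qed
  show "ff F y z = y" if "y \<in> insert x (Mpart F)" "z \<in> insert x (Mpart F)" for y z
  proof -
    have "y \<in> X" "z \<in> X" using that X(2,3) by auto
    moreover have "\<not> (y \<in> Vpart (restr F X) \<and> z \<in> Vpart (restr F X) \<and> y \<noteq> z)" using V that by metis
    ultimately show ?thesis using off(3) by blast
  qed
  show "\<not> rint F N_sym [y]" if "y \<in> Mpart F" for y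
    using K(4) that disj X(1,3) by (auto simp: parts_restr Npart_def)
  show "y \<notin> Vpart F" if "y \<in> Mpart F" for y using disj that .
qed

text \<open>Homogeneity applies to finitely generated substructures only. Adjoining \<open>x\<close>
  generates nothing new, since off their domain the functions return their first argument. A
  constant has an empty argument list, which counts as lying in the M-part.\<close>

lemma fraisse_fin_gen_point:
  assumes F: "fraisse_limit L0 lt M F" and x: "x \<in> Vpart F"
  shows "fin_gen_over (xlang L0) F (Mpart F) (insert x (Mpart F))"
proof -
  note p = fraisse_point[OF F x]
  have "closed_under L0 (Mstruct F) (Mpart F)"
    using F by (simp add: fraisse_limit_def is_struct_def Mstruct_def)
  then have "fint F (OldF s) xs \<in> Mpart F" if "s \<in> funs L0" "xs \<in> tuples (Mpart F) (fun_ar L0 s)" for s xs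
    using that by (simp add: closed_under_def Mstruct_def)
  then have old: "fint F (OldF s) xs \<in> insert x (Mpart F)"
    if "s \<in> funs L0" "xs \<in> tuples (insert x (Mpart F)) (fun_ar L0 s)" for s xs
    using that p(4)[OF that] by (cases "set xs \<subseteq> Mpart F"; cases xs) (auto simp: tuples_def)
  have "closed_under (xlang L0) F (insert x (Mpart F))"
    unfolding closed_under_def ball_funs_xlang using old p(6) by (auto simp: tuples_2)
  then have "generated (xlang L0) F {x} \<subseteq> insert x (Mpart F)"
    unfolding generated_def using x by (intro Inter_lower) (auto simp: Mpart_def Vpart_def)
  moreover have "x \<in> generated (xlang L0) F {x}" by (auto simp: generated_def)
  ultimately have "insert x (Mpart F) = generated (xlang L0) F {x} \<union> Mpart F" by blast
  then show ?thesis using x unfolding fin_gen_over_def Vpart_def by blast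
qed

lemma Mstruct_iso_elim:
  assumes "is_iso L0 (Mstruct F) M j"
  shows "bij_betw j (Mpart F) (univ M)"
    "\<And>s xs. s \<in> funs L0 \<Longrightarrow> xs \<in> tuples (Mpart F) (fun_ar L0 s) \<Longrightarrow>
      j (fint F (OldF s) xs) = fint M s (map j xs)"
    "\<And>R xs. R \<in> rels L0 \<Longrightarrow> xs \<in> tuples (Mpart F) (rel_ar L0 R) \<Longrightarrow>
      rint F (OldR R) xs \<longleftrightarrow> rint M R (map j xs)"
  using assms by (simp_all add: is_iso_def Mstruct_def)

text \<open>By \<open>fraisse_point\<close> only N distinguishes one V-point over the M-part from
  another, and the two-point structure is chosen with the same truth value of N as \<open>x\<close>.
  So either of its points can play the role of \<open>x\<close>.\<close>

lemma fraisse_point_iso_two_point: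
  assumes M: "countable (univ M)"
    and F: "fraisse_limit L0 lt M F" and x: "x \<in> Vpart F"
    and j: "is_iso L0 (Mstruct F) M j" and b: "b \<in> {0, Suc 0}"
  shows "is_iso (xlang L0) (restr F (insert x (Mpart F)))
      (restr (two_point M (rint F N_sym [x]) m) (insert b (mcode M ` univ M)))
      (\<lambda>v. if v = x then b else mcode M (j v))"
    (is "is_iso _ (restr F ?X) (restr ?B (insert b ?T)) ?c")
proof -
  note p = fraisse_point[OF F x]
  note j = Mstruct_iso_elim[OF j]
  have jM: "j v \<in> univ M" if "v \<in> Mpart F" for v using j(1) that by (auto simp: bij_betw_def)
  have cM: "?c v = mcode M (j v)" if "v \<in> Mpart F" for v using that p(1) by auto
  have bT: "b \<notin> ?T" using b by auto
  have cT: "?c v \<in> ?T \<longleftrightarrow> v \<in> Mpart F" if "v \<in> ?X" for v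
    using that p(1) bT jM by auto
  have sub: "set (map ?c xs) \<subseteq> ?T \<longleftrightarrow> set xs \<subseteq> Mpart F" if "xs \<in> tuples ?X n" for xs n
  proof -
    have "set xs \<subseteq> ?X" using that by (simp add: tuples_def)
    then have "(\<forall>v\<in>set xs. ?c v \<in> ?T) \<longleftrightarrow> (\<forall>v\<in>set xs. v \<in> Mpart F)"
      using cT by (intro ball_cong refl) blast
    then show ?thesis by (simp only: set_map subset_eq ball_simps)
  qed
  have dec: "map (mdecode M) (map ?c xs) = map j xs" if "set xs \<subseteq> Mpart F" for xs
    using that p(1) jM M by auto
  have inj: "inj_on (mcode M) (univ M)" using M by (metis inj_on_inverseI mdecode_mcode)
  have "bij_betw (mcode M \<circ> j) (Mpart F) ?T"
    by (rule bij_betw_trans[OF j(1)]) (rule inj_on_imp_bij_betw[OF inj])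
  then have "bij_betw ?c (Mpart F) ?T"
    by (rule bij_betw_cong[THEN iffD1, rotated]) (simp add: cM)
  then have "bij_betw ?c ?X (insert b ?T)"
    using notIn_Un_bij_betw[of x "Mpart F" ?c ?T] p(1) bT by simp
  moreover have "?c (fint F (OldF s) xs) = fint ?B (OldF s) (map ?c xs)"
    if s: "s \<in> funs L0" and xs: "xs \<in> tuples ?X (fun_ar L0 s)" for s xs
  proof (cases "set xs \<subseteq> Mpart F")
    case True
    then have xs': "xs \<in> tuples (Mpart F) (fun_ar L0 s)" using xs by (simp add: tuples_def)
    have "closed_under L0 (Mstruct F) (Mpart F)"
      using F by (simp add: fraisse_limit_def is_struct_def Mstruct_def)
    then have "fint F (OldF s) xs \<in> Mpart F" using s xs' by (simp add: closed_under_def Mstruct_def)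
    then have "?c (fint F (OldF s) xs) = mcode M (fint M s (map j xs))"
      using cM j(2)[OF s xs'] by metis
    then show ?thesis using True sub[OF xs] dec[OF True] by (simp only: two_point_simps if_True)
  next
    case False
    then have "fint F (OldF s) xs = hd xs" using p(4) s xs by blast
    moreover have "xs \<noteq> []" using False by auto
    ultimately have "?c (fint F (OldF s) xs) = hd (map ?c xs)" by (simp add: hd_map)
    then show ?thesis using False sub[OF xs] by (simp only: two_point_simps if_False)
  qed
  moreover have "rint F (OldR R) xs \<longleftrightarrow> rint ?B (OldR R) (map ?c xs)"
    if R: "R \<in> rels L0" and xs: "xs \<in> tuples ?X (rel_ar L0 R)" for R xs
  proof (cases "set xs \<subseteq> Mpart F")
    case True
    then have "xs \<in> tuples (Mpart F) (rel_ar L0 R)" using xs by (simp add: tuples_def)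
    from j(3)[OF R this] show ?thesis
      using True sub[OF xs] dec[OF True] by (simp only: two_point_simps simp_thms)
  next
    case False
    then show ?thesis using p(3) R xs sub[OF xs] by (auto simp only: two_point_simps)
  qed
  moreover have "?c (ff F y z) = ff ?B (?c y) (?c z)" if "y \<in> ?X" "z \<in> ?X" for y z
  proof -
    \<comment> \<open>Only \<open>b\<close> among 0 and 1 is a value of \<open>?c\<close>, so the
      two-point structure also returns the first argument here.\<close>
    have "{?c y, ?c z} \<noteq> {0, 1}"
      by (cases "y = x"; cases "z = x") (auto simp: doubleton_eq_iff)
    with p(6)[OF that] show ?thesis by (simp only: two_point_simps list.set if_False list.sel)
  qed
  moreover have "rint F Tri_sym [y, z] \<longleftrightarrow> rint ?B Tri_sym [?c y, ?c z]" if "y \<in> ?X" "z \<in> ?X" for y z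
  proof -
    have "\<not> (?c y = 0 \<and> ?c z = 1)"
      by (cases "y = x"; cases "z = x") auto
    with p(5)[OF that] show ?thesis by (simp only: two_point_simps list.inject simp_thms)
  qed
  moreover have "rint F V_sym [y] \<longleftrightarrow> rint ?B V_sym [?c y]"
    "rint F M_sym [y] \<longleftrightarrow> rint ?B M_sym [?c y]"
    "rint F N_sym [y] \<longleftrightarrow> rint ?B N_sym [?c y]" if y: "y \<in> ?X" for y
  proof -
    consider "y = x" | "y \<in> Mpart F" "y \<noteq> x" using y by blast
    then have "(rint F V_sym [y] \<longleftrightarrow> rint ?B V_sym [?c y]) \<and>
      (rint F M_sym [y] \<longleftrightarrow> rint ?B M_sym [?c y]) \<and> (rint F N_sym [y] \<longleftrightarrow> rint ?B N_sym [?c y])"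
    proof cases
      case 1
      then show ?thesis using p(1) b bT x by (simp add: Vpart_def Mpart_def)
    next
      case 2
      then show ?thesis using p(7,8)[of y] jM[of y] by (simp add: Vpart_def Mpart_def)
    qed
    then show "rint F V_sym [y] \<longleftrightarrow> rint ?B V_sym [?c y]"
      "rint F M_sym [y] \<longleftrightarrow> rint ?B M_sym [?c y]"
      "rint F N_sym [y] \<longleftrightarrow> rint ?B N_sym [?c y]" by blast+
  qed
  ultimately show ?thesis by (rule is_iso_xlang_restrI)
qed

text \<open>That the image of the coded M-part is all of \<open>Mpart F\<close>, and not just a part
  of it, lets this embedding be composed with the one-point isomorphism to meet the homogeneity
  clause.\<close>

lemma fraisse_two_point_embedding:
  assumes M: "is_struct L0 M" "countable (univ M)" and F: "fraisse_limit L0 lt M F"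
    and m: "m \<in> univ M"
  obtains X k where "X \<subseteq> univ F" "is_iso (xlang L0) (two_point M p m) (restr F X) k"
    "k ` (mcode M ` univ M) = Mpart F"
proof -
  from F obtain X h where X: "fin_gen_over (xlang L0) F (Mpart F) X"
    and h: "is_iso (xlang L0) (restr F X) (two_point M p m) h"
    using two_point_in_K[OF M m] unfolding fraisse_limit_def isomorphic_def by blast
  have FX: "in_K L0 lt M (restr F X)" using F X by (simp add: fraisse_limit_def)
  have "closed_under (xlang L0) F (univ F)" using F by (simp add: fraisse_limit_def is_struct_def)
  then have sub: "X \<subseteq> univ F" "Mpart F \<subseteq> X"
    using X by (auto simp: fin_gen_over_def generated_def Mpart_def)
  let ?k = "inv_into X h"
  have k: "is_iso (xlang L0) (two_point M p m) (restr F X) ?k"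
    using is_iso_inv[OF h] FX by (simp add: in_K_def is_struct_def)
  from parts_iso(2)[OF k] have "?k ` (mcode M ` univ M) = Mpart F"
    using sub by (simp add: two_point_parts parts_restr Int_absorb2)
  with sub(1) k show ?thesis using that by blast
qed

text \<open>The embedded pair has the right value only up to an automorphism of the M-part. This is
  repaired by moving \<open>x\<close> together with the entire M-part onto one end of the pair and
  pulling the other end back.\<close>

lemma fraisse_extension:
  assumes M: "is_struct L0 M" "countable (univ M)" and F: "fraisse_limit L0 lt M F"
    and x: "x \<in> Vpart F" and m: "m \<in> Mpart F"
  shows "\<exists>y\<in>Vpart F. (y, x) \<in> tri F \<and> ff F y x = m" (is ?left)
    and "\<exists>y\<in>Vpart F. (x, y) \<in> tri F \<and> ff F x y = m" (is ?right)
proof -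
  \<comment> \<open>\<open>b\<close> is the end of the pair that \<open>x\<close> is sent to: 0 puts
    the new point above \<open>x\<close>, 1 puts it below.\<close>
  have ext: "\<exists>y\<in>univ F. rint F V_sym [y] \<and> ff F x y = m \<and> ff F y x = m \<and>
      (b = 0 \<longrightarrow> rint F Tri_sym [x, y]) \<and> (b = 1 \<longrightarrow> rint F Tri_sym [y, x])"
    if b: "b \<in> {0, Suc 0}" for b
  proof -
    obtain j where j: "is_iso L0 (Mstruct F) M j"
      using F by (auto simp: fraisse_limit_def isomorphic_def)
    have mM: "j m \<in> univ M" using Mstruct_iso_elim(1)[OF j] m by (auto simp: bij_betw_def)
    let ?B = "two_point M (rint F N_sym [x]) (j m)" and ?X = "insert x (Mpart F)"
      and ?Z = "insert b (mcode M ` univ M)" and ?c = "\<lambda>v. if v = x then b else mcode M (j v)"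
    obtain Y k where Y: "Y \<subseteq> univ F" and k: "is_iso (xlang L0) ?B (restr F Y) k"
      and kT: "k ` (mcode M ` univ M) = Mpart F"
      using fraisse_two_point_embedding[OF M F mM] .
    have c: "is_iso (xlang L0) (restr F ?X) (restr ?B ?Z) ?c"
      using fraisse_point_iso_two_point[OF M(2) F x j b] .
    have Z: "?Z \<subseteq> univ ?B" using b by auto
    have kZ: "k ` ?Z = insert (k b) (Mpart F)" using kT by simp
    have "is_iso (xlang L0) (restr ?B ?Z) (restr F (insert (k b) (Mpart F))) k"
      using is_iso_restr[OF k Z] unfolding kZ by (simp add: restr_def)
    with c have iso: "is_iso (xlang L0) (restr F ?X) (restr F (insert (k b) (Mpart F))) (k \<circ> ?c)"
      by (rule is_iso_comp)
    note ke = is_iso_xlang_elim[OF k]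
    have k01: "k 0 \<in> univ F" "k 1 \<in> univ F" using ke(1) Y by auto
    have kV: "k i \<in> Vpart F" if "i \<in> {0, 1}" for i
      using ke(4)[of i] k01 that by (auto simp: Vpart_def)
    have "k b \<in> Vpart F" using kV b by auto
    then obtain g where g: "is_iso (xlang L0) F F g" and gX: "\<forall>v\<in>?X. g v = (k \<circ> ?c) v"
      using F fraisse_fin_gen_point[OF F] x iso unfolding fraisse_limit_def by blast
    note ge = is_iso_xlang_elim[OF g]
    have gx: "g x = k b" using gX by simp
    have "m \<noteq> x" using fraisse_point(1)[OF F x] m by blast
    then have gm: "g m = k (mcode M (j m))" using gX m by simp
    \<comment> \<open>\<open>1 - b\<close> is the other end of the pair, and \<open>y\<close> is its
      preimage under the automorphism.\<close>
    obtain y where y: "y \<in> univ F" "g y = k (1 - b)"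
      using k01 b ge(1) by (metis (no_types, opaque_lifting) One_nat_def diff_self_eq_0 diff_zero imageE insertE singletonD)
    have xm: "x \<in> univ F" "m \<in> univ F" using x m by (auto simp: Vpart_def Mpart_def)
    have univ_B: "b \<in> univ ?B" "1 - b \<in> univ ?B" using b by auto
    \<comment> \<open>Both sides are the image under \<open>k\<close> of the code of
      \<open>j m\<close>; injectivity of \<open>g\<close> then gives the value \<open>m\<close>
      itself.\<close>
    have "g (ff F x y) = g m" "g (ff F y x) = g m"
      using ge(3) xm y gx ke(3)[OF univ_B] ke(3)[OF univ_B(2,1)] b gm
      by (auto simp flip: ge(3) simp: insert_commute)
    moreover have "ff F x y \<in> univ F" "ff F y x \<in> univ F"
      using F xm y by (auto simp: fraisse_limit_def is_struct_def closed_under_def tuples_2 ball_funs_xlang)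
    ultimately have "ff F x y = m" "ff F y x = m" using ge(2) xm by (auto dest: inj_onD)
    moreover have "rint F V_sym [y]"
      using ge(4)[OF y(1)] y(2) kV[of "1 - b"] b by (auto simp: Vpart_def)
    moreover have "b = 0 \<longrightarrow> rint F Tri_sym [x, y]" "b = 1 \<longrightarrow> rint F Tri_sym [y, x]"
      using ge(7)[OF xm(1) y(1)] ge(7)[OF y(1) xm(1)] gx y(2)
        ke(7)[OF univ_B] ke(7)[OF univ_B(2,1)] by auto
    ultimately show ?thesis using y(1) by blast
  qed
  show ?left ?right using ext[of 1] ext[of 0] x by (auto simp: rel_on_def Vpart_def)
qed

text \<open>The clauses on V-points that name no new point hold in a member of the class around each
  triple. The order on the M-part is copied from \<open>M\<close> through \<open>j\<close>.\<close>

lemma V_axioms_fraisse: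
  assumes lt: "lt \<in> rels L0" "rel_ar L0 lt = 2" and M: "is_struct L0 M" "countable (univ M)"
    and lin: "strict_linear_order_on (univ M) (rel_on M lt (univ M))"
    and no_greatest: "\<forall>a\<in>univ M. \<exists>b\<in>univ M. (a, b) \<in> rel_on M lt (univ M)"
    and F: "fraisse_limit L0 lt M F"
  shows "V_axioms lt F"
proof -
  obtain j where j: "is_iso L0 (Mstruct F) M j"
    using F by (auto simp: fraisse_limit_def isomorphic_def)
  note je = Mstruct_iso_elim[OF j]
  have jM: "univ M = j ` Mpart F" and inj: "inj_on j (Mpart F)" using je(1) by (auto simp: bij_betw_def)
  have less: "(j v, j w) \<in> rel_on M lt (univ M) \<longleftrightarrow> (v, w) \<in> less_M lt F"
    if "v \<in> Mpart F" "w \<in> Mpart F" for v w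
    using that je(3)[OF lt(1), of "[v, w]"] lt(2) by (auto simp: rel_on_def jM tuples_2)
  obtain u where u: "u \<in> univ M" using M(1) by (auto simp: is_struct_def)
  \<comment> \<open>Any two-point member would serve: it is embedded only to produce a
    V-point.\<close>
  obtain X k where X: "X \<subseteq> univ F" and k: "is_iso (xlang L0) (two_point M False u) (restr F X) k"
    using fraisse_two_point_embedding[OF M F u] by metis
  have "k 0 \<in> Vpart F" using is_iso_xlang_elim(1,4)[OF k] X by (auto simp: Vpart_def)
  then have "Vpart F \<noteq> {}" by blast
  moreover have "((x, y) \<in> tri F \<longrightarrow> (y, z) \<in> tri F \<longrightarrow> (x, z) \<in> tri F) \<and>
      (x, x) \<notin> tri F \<and> (x \<noteq> y \<longrightarrow> ((x, y) \<in> tri F \<or> (y, x) \<in> tri F) \<and> ff F x y \<in> Mpart F) \<and>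
      ((x, y) \<in> tri F \<and> (y, z) \<in> tri F \<longrightarrow>
        (ff F x y = ff F x z \<and> ff F x z = ff F y z) \<or>
        (ff F x y = ff F x z \<and> (ff F x z, ff F y z) \<in> less_M lt F) \<or>
        (ff F x z = ff F y z \<and> (ff F y z, ff F x y) \<in> less_M lt F))"
    if V: "x \<in> Vpart F" "y \<in> Vpart F" "z \<in> Vpart F" for x y z
  proof -
    have "finite {x, y, z}" "{x, y, z} \<subseteq> univ F" using V by (auto simp: Vpart_def)
    from fraisse_in_K[OF F this] obtain X
      where X: "X \<subseteq> univ F" "{x, y, z} \<subseteq> X" "Mpart F \<subseteq> X" "in_K L0 lt M (restr F X)" .
    then show ?thesis using V
      unfolding in_K_def strict_linear_order_on_rel_on rel_on_restr fint_restr parts_restr[OF X(1)]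
      by (simp add: rel_on_def) blast
  qed
  moreover have "((x, y) \<in> less_M lt F \<longrightarrow> (y, z) \<in> less_M lt F \<longrightarrow> (x, z) \<in> less_M lt F) \<and>
      (x, x) \<notin> less_M lt F \<and> (x \<noteq> y \<longrightarrow> (x, y) \<in> less_M lt F \<or> (y, x) \<in> less_M lt F) \<and>
      (\<exists>m\<in>Mpart F. (x, m) \<in> less_M lt F)"
    if "x \<in> Mpart F" "y \<in> Mpart F" "z \<in> Mpart F" for x y z
  proof -
    have "j x \<in> univ M" "j y \<in> univ M" "j z \<in> univ M" using that jM by auto
    then have "((j x, j y) \<in> rel_on M lt (univ M) \<longrightarrow> (j y, j z) \<in> rel_on M lt (univ M) \<longrightarrow>
        (j x, j z) \<in> rel_on M lt (univ M)) \<and> (j x, j x) \<notin> rel_on M lt (univ M) \<and>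
      (j x \<noteq> j y \<longrightarrow> (j x, j y) \<in> rel_on M lt (univ M) \<or> (j y, j x) \<in> rel_on M lt (univ M)) \<and>
      (\<exists>m\<in>univ M. (j x, m) \<in> rel_on M lt (univ M))"
      using lin no_greatest unfolding strict_linear_order_on_rel_on by blast
    moreover have "j x = j y \<longleftrightarrow> x = y" using inj that by (meson inj_onD)
    moreover have "(\<exists>m\<in>univ M. (j x, m) \<in> rel_on M lt (univ M)) \<longleftrightarrow> (\<exists>m\<in>Mpart F. (x, m) \<in> less_M lt F)"
      using less[OF that(1)] unfolding jM by blast
    ultimately show ?thesis using less that by simp
  qed
  ultimately show ?thesis
    unfolding V_axioms_def strict_linear_order_on_rel_on
    by (intro conjI) (use fraisse_extension[OF M F] in blast)+
qed

section \<open>From the limit to arbitrary models of its Scott sentence\<close>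

lemma V_axioms_model:
  assumes L0: "countable_lang L0" and lt: "lt \<in> rels L0" "rel_ar L0 lt = 2"
    and F: "V_axioms lt F" and scott: "scott_sentence (xlang L0) F \<phi>"
    and G: "model_of (xlang L0) \<phi> G"
  shows "V_axioms lt G"
proof (rule V_axioms_local)
  show "univ G \<noteq> {}" using G by (simp add: model_of_def is_struct_def)
next
  fix x y z assume xyz: "{x, y, z} \<subseteq> univ G"
  have sent: "sentence (xlang L0) \<phi>" using scott by (simp add: scott_sentence_def)
  obtain X where X: "countable X" "{x, y, z} \<subseteq> X" "X \<subseteq> univ G" "model_of (xlang L0) \<phi> (restr G X)"
    using downward_Loewenheim_Skolem[OF countable_xlang[OF L0] sent G _ xyz] by auto
  obtain B :: "('a, 'b, nat) xstruct" and h
    where B: "model_of (xlang L0) \<phi> B" and h: "is_iso (xlang L0) B (restr G X) h"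
    using countable_model_has_nat_copy[OF X(4) sent] X(1) by auto
  \<comment> \<open>The only use of the categoricity of the Scott sentence among countable models.
    The axioms then travel from \<open>F\<close> to \<open>B\<close> and on to the submodel.\<close>
  obtain k where "is_iso (xlang L0) F B k"
    using scott B by (auto simp: scott_sentence_def isomorphic_def)
  then have "V_axioms lt B" using V_axioms_iso[OF _ lt F] by blast
  then have "V_axioms lt (restr G X)" using V_axioms_iso[OF h lt] by blast
  with X show "\<exists>X\<subseteq>univ G. {x, y, z} \<subseteq> X \<and> V_axioms lt (restr G X)" by blast
qed

text \<open>Every alternative of the triple clause gives f(y,x) at most f(y',x) for y below y' below
  x; above \<open>x\<close> the order is reversed, which the converse relation absorbs. The transfer
  works for each cardinal separately and all orders live on one type, so \<open>least_in\<close>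
  chooses from equal sets and the results are equal outright, not merely \<open>=o\<close>.\<close>

lemma V_axioms_char:
  assumes G: "V_axioms lt G" and x: "x \<in> Vpart G"
  shows "left_char (Vpart G) (tri G) x = cofinality (Mpart G) (less_M lt G)"
    and "right_char (Vpart G) (tri G) x = cofinality (Mpart G) (less_M lt G)"
proof -
  let ?s = "less_M lt G" and ?r = "tri G"
  let ?L = "{y \<in> Vpart G. (y, x) \<in> ?r}" and ?R = "{y \<in> Vpart G. (x, y) \<in> ?r}"
  note D = V_axiomsD[OF G]
  have "(\<exists>g. cofinal_map ?r ?L \<kappa> g) \<longleftrightarrow> (\<exists>g. cofinal_map ?s (Mpart G) \<kappa> g)" for \<kappa> :: "'c rel"
  proof (rule cofinal_map_transfer[where f = "\<lambda>y. ff G y x", OF D(5) D(8)])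
    show "(\<lambda>y. ff G y x) ` ?L = Mpart G" using D(11)[OF x] D(13) by blast
    show "total_on ?L ?r" using D(4) by (auto simp: total_on_def)
    show "ff G y x = ff G y' x \<or> (ff G y x, ff G y' x) \<in> ?s" if "(y, y') \<in> ?r" "y \<in> ?L" "y' \<in> ?L" for y y'
      using D(10)[of y y' x] that by auto
  qed (use D(6) in auto)
  then show "left_char (Vpart G) ?r x = cofinality (Mpart G) ?s"
    unfolding left_char_def cofinality_def by simp
  have "(\<exists>g. cofinal_map (?r\<inverse>) ?R \<kappa> g) \<longleftrightarrow> (\<exists>g. cofinal_map ?s (Mpart G) \<kappa> g)" for \<kappa> :: "'c rel"
  proof (rule cofinal_map_transfer[where f = "\<lambda>y. ff G x y", OF D(5) D(8)])
    show "(\<lambda>y. ff G x y) ` ?R = Mpart G" using D(12)[OF x] D(13) by blast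
    show "total_on ?R (?r\<inverse>)" using D(4) by (auto simp: total_on_def)
    show "ff G x y = ff G x y' \<or> (ff G x y, ff G x y') \<in> ?s"
      if "(y, y') \<in> ?r\<inverse>" "y \<in> ?R" "y' \<in> ?R" for y y'
      using D(10)[of x y' y] that by auto
  qed (use D(6) in auto)
  then show "right_char (Vpart G) ?r x = cofinality (Mpart G) ?s"
    unfolding right_char_def cofinality_def by simp
qed

theorem theorem4p10:
  fixes L0 :: "('f, 'r) lang" and lt :: 'r
    and M :: "('f, 'r, 'm) struct" and \<phi> :: "('f, 'r) fm"
    and F :: "('f, 'r, 'a) xstruct" and \<phi>\<^sub>F :: "('f xfun, 'r xrel) fm"
    and G :: "('f, 'r, 'g) xstruct"
  assumes "countable_lang L0" and "lt \<in> rels L0" and "rel_ar L0 lt = 2"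
    and "is_struct L0 M" and "countable (univ M)"
    and "strict_linear_order_on (univ M) (rel_on M lt (univ M))"
    and no_greatest: "\<forall>a\<in>univ M. \<exists>b\<in>univ M. (a, b) \<in> rel_on M lt (univ M)"
    and "scott_sentence L0 M \<phi>"
    and "has_model_of_card L0 \<phi> aleph1" and "\<not> has_model_of_card L0 \<phi> aleph2"
    and "fraisse_limit L0 lt M F" and "scott_sentence (xlang L0) F \<phi>\<^sub>F"
    and "model_of (xlang L0) \<phi>\<^sub>F G"
  shows "strict_linear_order_on (Vpart G) (tri G) \<and>
         order_char (Vpart G) (tri G) =o cofinality (Mpart G) (less_M lt G)"
proof -
  have "V_axioms lt F" using V_axioms_fraisse[of lt L0 M F] assms by blast
  then have G: "V_axioms lt G" using V_axioms_model[of L0 lt F \<phi>\<^sub>F G] assms by blast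
  let ?c = "cofinality (Mpart G) (less_M lt G)"
  have card: "Card_order ?c" by (rule Card_order_cofinality)
  \<comment> \<open>The two characters coincide, so the minimum is taken over a singleton and the
    choice is forced; the same happens below for the minimum over all points.\<close>
  have "point_char (Vpart G) (tri G) x = ?c" if "x \<in> Vpart G" for x
    using V_axioms_char[OF G that] least_in_singleton[OF card] by (simp add: point_char_def)
  moreover have "Vpart G \<noteq> {}" using G by (simp add: V_axioms_def)
  ultimately have "point_char (Vpart G) (tri G) ` Vpart G = {?c}" by auto
  then have "order_char (Vpart G) (tri G) = ?c"
    using least_in_singleton[OF card] by (simp add: order_char_def)
  moreover have "strict_linear_order_on (Vpart G) (tri G)" using G by (simp add: V_axioms_def)
  moreover have "?c =o ?c" using card by (rule card_order_on_well_order_on[THEN ordIso_reflexive])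
  ultimately show ?thesis by simp
qed

end
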